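(* Consider the problem $\min\{f(x):x\in X,\ g(x)\le0\}$ with a solution $x_*$. Assume that for some constants $M_f,M_g$ $$|f(x)-f(y)|\le M_f\|x-y\|_E,\qquad |g(x)-g(y)|\le M_g\|x-y\|_E\qquad\text{for all }x,y\in X,$$ and that stochastic subgradients $\nabla f(x,\xi)$, $\nabla g(x,\zeta)$ are available, which for $x\in X$ satisfy $$\mathbb{E}[\nabla f(x,\xi)]=\nabla f(x)\in\partial f(x),\qquad \mathbb{E}[\nabla g(x,\zeta)]=\nabla g(x)\in\partial g(x),$$ $$\|\nabla f(x,\xi)\|_{E,*}\le M_f,\qquad\|\nabla g(x,\zeta)\|_{E,*}\le M_g\qquad\text{a.s. in }\xi,\zeta .$$ Let $f$ and $g$ be strongly convex with the same parameter $\mu$. Also assume that the Bregman divergence of the prox-function $d$ satisfies $V[z](x)\le\frac\Omega2\|x-z\|_E^2$ for $x,z\in X$, where $\Omega$ is a known number, and that the starting point $x_0\in X$ and the number $R_0>0$ are such that $\|x_0-x_*\|_E^2\le R_0^2$. Let $\varepsilon>0$ and $\sigma\in(0,1)$. Then the point $x_p$ returned by the restarted Stochastic Mirror Descent algorithm (described in the context) is an $(\varepsilon,\sigma)$-solution of the problem, i.e. $$\mathbb{P}\left\{f(x_p)-f(x_* )\le\varepsilon,\quad g(x_p)\le\varepsilon\right\}\ge1-\sigma,$$ and $\|x_p-x_*\|_E^2\le\frac{2\varepsilon}{\mu}$ with probability at least $1-\sigma$. At the same time, the total number of iterations of the inner algorithm (Stochastic Mirror Descent) does not exceed $$\left\lceil\log_2\frac{\mu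 R_0^2}{2\varepsilon}\right\rceil+\frac{2240\,\Omega\max\{M_f^2,M_g^2\}}{\mu\varepsilon}\left(\ln\frac1\sigma+\ln\log_2\frac{\mu R_0^2}{2\varepsilon}\right).$$
   Context: **Problem.** $E$ is a finite-dimensional real vector space with norm $\|\cdot\|_E$, $E^*$ its dual, $\langle p,x\rangle$ the value of $p\in E^*$ at $x\in E$, and $\|p\|_{E,*}=\max\{\langle p,x\rangle:\|x\|_E\le1\}$. $X\subset E$ is closed and convex; $f:X\to\mathbb{R}$ and $g:E\to\mathbb{R}$ are convex. The problem is regular: there is a point $\bar x$ in the relative interior of $X$ with $g(\bar x)<0$. $\nabla f(x)$, $\nabla g(x)$ denote any subgradients of $f$, $g$ at $x$. Strong convexity of $f$ with parameter $\mu$ means $f(y)\ge f(x)+\langle\nabla f(x),y-x\rangle+\frac\mu2\|y-x\|_E^2$ for all $x,y\in X$; similarly for $g$. $\xi,\zeta$ are random vectors; exact values $g(x)$ can be used, and the constants $M_f,M_g$ are known. **Prox-function.** $d$ is continuous and convex on $X$; on the set $X^0\subseteq X$ of points where a subgradient of $d$ exists it admits a continuous selection of subgradients $\nabla d(x)$; it is 1-strongly convex on $X$ with respect to $\|\cdot\|_E$: $d(y)-d(x)-\langle\nabla d(x),y-x\rangle\ge\frac12\|y-x\|_E^2$ for $x\in X^0,y\in X$; $\min_{x\in X}d(x)=0$; and $0=\arg\min_{x\in X}d(x)$. The Bregman divergence is $V[z](x)=d(x)-d(z)-\langle\nabla d(z),x-z\rangle$. **Inner algorithm (Stochastic Mirror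 Descent).** Inputs: accuracy $\delta>0$, number of iterations $N$, feasible set $Q$, prox-function $\tilde d$, and stepsize $h>0$. Put $\mathrm{Mirr}[x](p)=\arg\min_{u\in Q}\{\langle p,u\rangle+\tilde d(u)-\langle\nabla\tilde d(x),u\rangle\}$, assumed to be easily computable. Start with $x^0=\arg\min_{x\in Q}\tilde d(x)$, $I=\emptyset$. For $k=0,\dots,N-1$, with independent realizations $\xi^k,\zeta^k$ of $\xi,\zeta$ generated on each iteration: if $g(x^k)\le\delta$, set $x^{k+1}=\mathrm{Mirr}[x^k](h\nabla f(x^k,\xi^k))$ and add $k$ to $I$; otherwise set $x^{k+1}=\mathrm{Mirr}[x^k](h\nabla g(x^k,\zeta^k))$. Output $\frac1{|I|}\sum_{i\in I}x^i$ if $I\ne\emptyset$, and $NULL$ otherwise ($|I|$ is the number of elements of $I$). **Restarted algorithm.** Set $d_0(x)=d\big(\frac{x-x_0}{R_0}\big)$. For $p=1,2,\dots$: set $R_p^2=R_0^2\,2^{-p}$, $\varepsilon_p=\frac{\mu R_p^2}{2}$, $$N_p=\left\lceil70\,\frac{\max\{M_f^2,M_g^2\}\,\Omega R_{p-1}^2}{\varepsilon_p^2}\ln\Big(\frac1\sigma\log_2\frac{\mu R_0^2}{2\varepsilon}\Big)\right\rceil,\qquad X_p=\{x\in X:\|x-x_{p-1}\|_E^2\le R_{p-1}^2\};$$ let $x_p$ be the output of the inner algorithm with accuracy $\varepsilon_p$, $N_p$ iterations, feasible set $X_p$, prox-function $d_{p-1}$ (which is 1-strongly convex with respect to the norm $\|\cdot\|_E/R_{p-1}$,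 whose dual norm is $R_{p-1}\|\cdot\|_{E,*}$), $\Omega$ in the role of the upper bound $\Theta_0^2$ on the Bregman divergence of $d_{p-1}$ over $X_p$, and accordingly stepsize $h=\frac{\varepsilon_p}{\max\{M_f^2,M_g^2\}R_{p-1}^2}$; set $d_p(x)=d\big(\frac{x-x_p}{R_p}\big)$. Stop after the first stage $p$ with $p\ge\log_2\frac{\mu R_0^2}{2\varepsilon}$ and return $x_p$.
   Formalization: With L = log_2(μR_0²/(2ε)), 2σ ≤ min{L, L²} is assumed (for L = 1 and σ near 1 the algorithm can return NULL); d and its conditions live on a closed convex D containing X and the rescaled points (x−x_{p−1})/R_{p−1} used; max{M_f²,M_g²} > 0 and Ω > 0. *)

theory Defs
  imports "HOL-Probability.Probability"
begin

(* The space E is a type of class euclidean_space, used only for its linear structure and its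
   (norm-independent) topology and Borel sets; the norm of the problem is an arbitrary norm nE
   on it.  A functional p in the dual is represented by the vector p with <p,x> = p \<bullet> x. *)

definition is_norm :: "('a::real_vector \<Rightarrow> real) \<Rightarrow> bool" where
  "is_norm nE \<longleftrightarrow>
     (\<forall>x. nE x = 0 \<longleftrightarrow> x = 0) \<and>
     (\<forall>x y. nE (x + y) \<le> nE x + nE y) \<and>
     (\<forall>c x. nE (c *\<^sub>R x) = \<bar>c\<bar> * nE x)"

definition dual_norm :: "('a::euclidean_space \<Rightarrow> real) \<Rightarrow> 'a \<Rightarrow> real" where
  "dual_norm nE p = (SUP x\<in>{x. nE x \<le> 1}. p \<bullet> x)"

(* Subgradients of a function whose domain is S. *)
definition subdifferential :: "'a::euclidean_space set \<Rightarrow> ('a \<Rightarrow> real) \<Rightarrow> 'a \<Rightarrow> 'a set" where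
  "subdifferential S f x = {p. \<forall>y\<in>S. f y \<ge> f x + p \<bullet> (y - x)}"

(* Strong convexity on X, for a function with domain S, with respect to any choice of
   subgradients. *)
definition strongly_convex ::
  "('a::euclidean_space \<Rightarrow> real) \<Rightarrow> real \<Rightarrow> 'a set \<Rightarrow> 'a set \<Rightarrow> ('a \<Rightarrow> real) \<Rightarrow> bool" where
  "strongly_convex nE \<mu> S X f \<longleftrightarrow>
     (\<forall>x\<in>X. \<forall>y\<in>X. \<forall>p\<in>subdifferential S f x.
        f y \<ge> f x + p \<bullet> (y - x) + \<mu> / 2 * (nE (y - x))\<^sup>2)"

definition subgrad_points :: "'a::euclidean_space set \<Rightarrow> ('a \<Rightarrow> real) \<Rightarrow> 'a set" where
  "subgrad_points D d = {x \<in> D. subdifferential D d x \<noteq> {}}"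

(* D is the domain of d.  It is kept separate from the feasible set X because the restarted
   method evaluates d at the rescaled points (x - y) / r with x, y in X, which need not lie in X. *)
definition prox_function ::
  "('a::euclidean_space \<Rightarrow> real) \<Rightarrow> 'a set \<Rightarrow> ('a \<Rightarrow> real) \<Rightarrow> ('a \<Rightarrow> 'a) \<Rightarrow> bool" where
  "prox_function nE D d gd \<longleftrightarrow>
     closed D \<and> continuous_on D d \<and> convex_on D d \<and>
     (\<forall>x\<in>subgrad_points D d. gd x \<in> subdifferential D d x) \<and>
     continuous_on (subgrad_points D d) gd \<and>
     (\<forall>x\<in>subgrad_points D d. \<forall>y\<in>D. d y - d x - gd x \<bullet> (y - x) \<ge> 1 / 2 * (nE (y - x))\<^sup>2) \<and>
     is_arg_min d (\<lambda>x. x \<in> D) 0 \<and> d 0 = 0"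

definition bregman ::
  "('a::euclidean_space \<Rightarrow> real) \<Rightarrow> ('a \<Rightarrow> 'a) \<Rightarrow> 'a \<Rightarrow> 'a \<Rightarrow> real" where
  "bregman d gd z x = d x - d z - gd z \<bullet> (x - z)"

definition mirr ::
  "'a::euclidean_space set \<Rightarrow> ('a \<Rightarrow> real) \<Rightarrow> ('a \<Rightarrow> 'a) \<Rightarrow> 'a \<Rightarrow> 'a \<Rightarrow> 'a" where
  "mirr Q d gd x p = arg_min_on (\<lambda>u. p \<bullet> u + d u - gd x \<bullet> u) Q"

primrec smd_iter ::
  "('a::euclidean_space \<Rightarrow> real) \<Rightarrow> ('a \<Rightarrow> 'b \<Rightarrow> 'a) \<Rightarrow> ('a \<Rightarrow> 'c \<Rightarrow> 'a) \<Rightarrow> real \<Rightarrow> 'a set \<Rightarrow>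
   ('a \<Rightarrow> real) \<Rightarrow> ('a \<Rightarrow> 'a) \<Rightarrow> real \<Rightarrow> (nat \<Rightarrow> 'b) \<Rightarrow> (nat \<Rightarrow> 'c) \<Rightarrow> nat \<Rightarrow> 'a" where
  "smd_iter g Gf Gg \<delta> Q d gd h \<xi> \<zeta> 0 = arg_min_on d Q"
| "smd_iter g Gf Gg \<delta> Q d gd h \<xi> \<zeta> (Suc k) =
     (let x = smd_iter g Gf Gg \<delta> Q d gd h \<xi> \<zeta> k in
      if g x \<le> \<delta> then mirr Q d gd x (h *\<^sub>R Gf x (\<xi> k))
      else mirr Q d gd x (h *\<^sub>R Gg x (\<zeta> k)))"

(* None is the output NULL. *)
definition smd ::
  "('a::euclidean_space \<Rightarrow> real) \<Rightarrow> ('a \<Rightarrow> 'b \<Rightarrow> 'a) \<Rightarrow> ('a \<Rightarrow> 'c \<Rightarrow> 'a) \<Rightarrow> real \<Rightarrow> nat \<Rightarrow> 'a set \<Rightarrow>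
   ('a \<Rightarrow> real) \<Rightarrow> ('a \<Rightarrow> 'a) \<Rightarrow> real \<Rightarrow> (nat \<Rightarrow> 'b) \<Rightarrow> (nat \<Rightarrow> 'c) \<Rightarrow> 'a option" where
  "smd g Gf Gg \<delta> N Q d gd h \<xi> \<zeta> =
     (let x = smd_iter g Gf Gg \<delta> Q d gd h \<xi> \<zeta>; I = {k. k < N \<and> g (x k) \<le> \<delta>} in
      if I = {} then None else Some ((1 / real (card I)) *\<^sub>R (\<Sum>i\<in>I. x i)))"

definition radius :: "real \<Rightarrow> nat \<Rightarrow> real" where
  "radius R0 p = sqrt (R0\<^sup>2 / 2 ^ p)"

definition stage_acc :: "real \<Rightarrow> real \<Rightarrow> nat \<Rightarrow> real" where
  "stage_acc \<mu> R0 p = \<mu> * (radius R0 p)\<^sup>2 / 2"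

definition log_stages :: "real \<Rightarrow> real \<Rightarrow> real \<Rightarrow> real" where
  "log_stages \<mu> R0 \<epsilon> = log 2 (\<mu> * R0\<^sup>2 / (2 * \<epsilon>))"

definition num_stages :: "real \<Rightarrow> real \<Rightarrow> real \<Rightarrow> nat" where
  "num_stages \<mu> R0 \<epsilon> = (LEAST p. 1 \<le> p \<and> log_stages \<mu> R0 \<epsilon> \<le> real p)"

(* Meaningful for stages p \<ge> 1 only. *)
definition stage_iters ::
  "real \<Rightarrow> real \<Rightarrow> real \<Rightarrow> real \<Rightarrow> real \<Rightarrow> real \<Rightarrow> real \<Rightarrow> nat \<Rightarrow> nat" where
  "stage_iters Mf Mg \<Omega> \<mu> R0 \<epsilon> \<sigma> p =
     nat \<lceil>70 * (max (Mf\<^sup>2) (Mg\<^sup>2) * \<Omega> * (radius R0 (p - 1))\<^sup>2 / (stage_acc \<mu> R0 p)\<^sup>2)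
          * ln (1 / \<sigma> * log_stages \<mu> R0 \<epsilon>)\<rceil>"

(* The point x_p after p stages; the run is aborted with None as soon as a stage outputs NULL.
   The subgradient selection of x \<mapsto> d ((x - y) / r) is x \<mapsto> gd ((x - y) / r) / r. *)
primrec restarted_smd ::
  "('a::euclidean_space \<Rightarrow> real) \<Rightarrow> 'a set \<Rightarrow> ('a \<Rightarrow> real) \<Rightarrow> ('a \<Rightarrow> 'b \<Rightarrow> 'a) \<Rightarrow> ('a \<Rightarrow> 'c \<Rightarrow> 'a) \<Rightarrow>
   ('a \<Rightarrow> real) \<Rightarrow> ('a \<Rightarrow> 'a) \<Rightarrow> real \<Rightarrow> real \<Rightarrow> real \<Rightarrow> real \<Rightarrow> real \<Rightarrow> real \<Rightarrow> real \<Rightarrow> 'a \<Rightarrow>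
   (nat \<Rightarrow> nat \<Rightarrow> 'b) \<Rightarrow> (nat \<Rightarrow> nat \<Rightarrow> 'c) \<Rightarrow> nat \<Rightarrow> 'a option" where
  "restarted_smd nE X g Gf Gg d gd Mf Mg \<Omega> \<mu> R0 \<epsilon> \<sigma> x0 \<xi> \<zeta> 0 = Some x0"
| "restarted_smd nE X g Gf Gg d gd Mf Mg \<Omega> \<mu> R0 \<epsilon> \<sigma> x0 \<xi> \<zeta> (Suc p) =
     (case restarted_smd nE X g Gf Gg d gd Mf Mg \<Omega> \<mu> R0 \<epsilon> \<sigma> x0 \<xi> \<zeta> p of
        None \<Rightarrow> None
      | Some y \<Rightarrow>
          (let r = radius R0 p; \<delta> = stage_acc \<mu> R0 (Suc p) in
           smd g Gf Gg \<delta> (stage_iters Mf Mg \<Omega> \<mu> R0 \<epsilon> \<sigma> (Suc p))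
             {x \<in> X. (nE (x - y))\<^sup>2 \<le> r\<^sup>2}
             (\<lambda>x. d ((1 / r) *\<^sub>R (x - y)))
             (\<lambda>x. (1 / r) *\<^sub>R gd ((1 / r) *\<^sub>R (x - y)))
             (\<delta> / (max (Mf\<^sup>2) (Mg\<^sup>2) * r\<^sup>2))
             (\<xi> (Suc p)) (\<zeta> (Suc p))))"

end

theory Submission
  imports Defs
begin

text \<open>A stage that starts at a center y within distance R of the solution xs runs mirror descent on the
part of X in the ball of radius R around y. Mirror descent bounds the sum of
\<open>G k \<bullet> (x k - xs)\<close> over the stochastic subgradients G k that it uses. After replacing each G k by
its mean, a subgradient, a step at a point with g at most \<delta> contributes at least f (x k) - f xs to this
sum, and any other step contributes more than \<delta>. The step size makes the sum at most N * \<delta> after N steps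
as long as the accumulated noise \<open>(mean - G k) \<bullet> (x k - xs)\<close> stays below a threshold of order N * \<delta> / 2.
Then some step has g at most \<delta>, and the average x of the points of these steps has f x - f xs and
g x at most \<delta> (lemma stage_success).

The function max (f - f xs) g is strongly convex, vanishes at xs and is nonnegative on X. Hence
accuracy \<delta> in both functions means that the squared distance to xs is at most 2 * \<delta> / \<mu> (lemma
quadratic_growth_at_solution). The accuracy of a stage is chosen so that this is half of the squared
radius, so the next stage starts as required, and the last stage has accuracy at most \<epsilon>.

It remains to bound the probability that some stage is too noisy. Given the past, each noise
term is centered and lies in an interval of length 4 M R, where M bounds the dual norms of the
stochastic subgradients. Hoeffding's lemma, applied conditionally one step at a time, bounds the
exponential moment of the sum, and Markov's inequality makes a stage too noisy while its start is still
close to xs with probability at most (\<sigma> / L)^2, where L is the logarithm that determines the number of stages (lemma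
prob_too_noisy). The constant 70 in the number of iterations is what makes the exponent 2. The union
bound over the L (rounded up) stages costs at most \<sigma>, by the relation between \<sigma> and L.

Two points need more care than this sketch shows. The mirror step must be usable again at
its own result, with the selected subgradient gd and not with an arbitrary one. The quadratic upper
bound on the Bregman divergence settles this: it bounds the relevant part of gd, so that d
is subdifferentiable on all of its domain D (lemma subgrad_points_eq_domain), and it makes gd satisfy the
optimality condition of the step (lemma step_optimality). Moreover the random run must be measurable, although each
step picks a minimizer over a set that moves with the random center. This holds because the
minimizer is unique and depends continuously on the center and the dual variable (lemma
continuous_on_step).\<close>

section \<open>Arbitrary norms on a Euclidean space\<close>

lemma is_norm_nonneg:
  assumes "is_norm nE" shows "0 \<le> nE x"
proof -
  have "nE (x + (-1) *\<^sub>R x) \<le> nE x + nE ((-1) *\<^sub>R x)" "nE ((-1) *\<^sub>R x) = \<bar>-1\<bar> * nE x" "nE 0 = 0"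
    using assms unfolding is_norm_def by blast+
  then show ?thesis by simp
qed

lemma is_norm_minus_commute:
  assumes "is_norm nE" shows "nE (x - y) = nE (y - x)"
proof -
  have "nE ((-1) *\<^sub>R (x - y)) = \<bar>-1\<bar> * nE (x - y)"
    using assms unfolding is_norm_def by blast
  then show ?thesis by simp
qed

lemma is_norm_triangle: "is_norm nE \<Longrightarrow> nE (x + y) \<le> nE x + nE y"
  by (auto simp: is_norm_def)

lemma is_norm_scaleR: "is_norm nE \<Longrightarrow> nE (c *\<^sub>R x) = \<bar>c\<bar> * nE x"
  by (auto simp: is_norm_def)

lemma is_norm_zero [simp]: "is_norm nE \<Longrightarrow> nE 0 = 0"
  by (auto simp: is_norm_def)

lemma is_norm_eq_0: "is_norm nE \<Longrightarrow> nE x = 0 \<longleftrightarrow> x = 0"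
  by (auto simp: is_norm_def)

lemma is_norm_continuous:
  fixes nE :: "'a::euclidean_space \<Rightarrow> real"
  assumes n: "is_norm nE" shows "continuous_on A nE"
proof -
  have "convex_on UNIV nE"
    unfolding convex_on_def
  proof (intro conjI ballI allI impI)
    fix x y :: 'a and u v :: real assume "u \<ge> 0" "v \<ge> 0" "u + v = 1"
    then show "nE (u *\<^sub>R x + v *\<^sub>R y) \<le> u * nE x + v * nE y"
      using is_norm_triangle[OF n, of "u *\<^sub>R x" "v *\<^sub>R y"] by (simp add: is_norm_scaleR[OF n])
  qed auto
  then have "continuous_on UNIV nE" by (rule convex_on_continuous[OF open_UNIV])
  then show ?thesis by (rule continuous_on_subset) auto
qed

text \<open>Equivalence with the Euclidean norm, by compactness of the Euclidean sphere. This is what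
makes balls of an arbitrary norm compact.\<close>
lemma is_norm_lower_bound:
  fixes nE :: "'a::euclidean_space \<Rightarrow> real"
  assumes n: "is_norm nE" obtains b where "b > 0" "\<And>x. b * norm x \<le> nE x"
proof -
  have "compact (sphere (0::'a) 1)" "sphere (0::'a) 1 \<noteq> {}" by auto
  then obtain s where s: "s \<in> sphere (0::'a) 1" and min: "\<forall>x\<in>sphere 0 1. nE s \<le> nE x"
    using continuous_attains_inf[OF _ _ is_norm_continuous[OF n]] by blast
  have "s \<noteq> 0" using s by auto
  then have "nE s > 0" using is_norm_nonneg[OF n, of s] is_norm_eq_0[OF n, of s] by auto
  moreover have "nE s * norm x \<le> nE x" for x
  proof (cases "x = 0")
    case False
    then have "nE s \<le> nE ((1 / norm x) *\<^sub>R x)" using min by auto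
    then show ?thesis using False by (simp add: is_norm_scaleR[OF n] field_simps)
  qed (simp add: n)
  ultimately show ?thesis using that by blast
qed

lemma compact_norm_ball:
  fixes nE :: "'a::euclidean_space \<Rightarrow> real"
  assumes n: "is_norm nE" and "closed X"
  shows "compact {x \<in> X. nE (x - y) \<le> r}"
proof -
  obtain b where b: "b > 0" "\<And>x. b * norm x \<le> nE x" using is_norm_lower_bound[OF n] by blast
  have "closed ({x. nE (x - y) \<le> r} \<inter> X)"
    by (intro closed_Int assms closed_Collect_le continuous_on_compose2[OF is_norm_continuous[OF n, of UNIV]]
        continuous_intros) auto
  moreover have "{x \<in> X. nE (x - y) \<le> r} \<subseteq> cball y (r / b)"
  proof
    fix x assume "x \<in> {x \<in> X. nE (x - y) \<le> r}"
    then have "b * norm (x - y) \<le> r" using b(2)[of "x - y"] by auto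
    then show "x \<in> cball y (r / b)" using b(1) by (simp add: field_simps dist_norm norm_minus_commute)
  qed
  moreover have "{x. nE (x - y) \<le> r} \<inter> X = {x \<in> X. nE (x - y) \<le> r}" by blast
  ultimately show ?thesis
    using bounded_subset[OF bounded_cball] by (metis compact_eq_bounded_closed)
qed

lemma dual_norm_bdd_above:
  fixes nE :: "'a::euclidean_space \<Rightarrow> real"
  assumes n: "is_norm nE" shows "bdd_above ((\<lambda>x. p \<bullet> x) ` {x. nE x \<le> 1})"
proof -
  have "compact {x \<in> UNIV. nE (x - 0) \<le> 1}" by (rule compact_norm_ball[OF n closed_UNIV])
  then have "compact ((\<lambda>x. p \<bullet> x) ` {x. nE x \<le> 1})"
    by (intro compact_continuous_image continuous_intros) simp
  then show ?thesis by (intro bounded_imp_bdd_above compact_imp_bounded)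
qed

lemma inner_le_dual_norm:
  fixes nE :: "'a::euclidean_space \<Rightarrow> real"
  assumes n: "is_norm nE" shows "p \<bullet> v \<le> dual_norm nE p * nE v"
proof (cases "v = 0")
  case False
  then have pos: "nE v > 0" using is_norm_nonneg[OF n, of v] is_norm_eq_0[OF n, of v] by auto
  have "p \<bullet> ((1 / nE v) *\<^sub>R v) \<le> dual_norm nE p" unfolding dual_norm_def
    by (rule cSUP_upper[OF _ dual_norm_bdd_above[OF n]]) (use pos in \<open>simp add: is_norm_scaleR[OF n]\<close>)
  then show ?thesis using pos by (simp add: field_simps)
qed (simp add: n)

section \<open>Subdifferentiability of the prox-function\<close>

text \<open>First-order conditions at a minimizer u are read off from here: comparing u with
u + t * (y - u) gives the directional derivative as a and a remainder of order t^2.\<close>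
lemma nonneg_if_quadratic_nonneg:
  fixes a b :: real
  assumes "\<And>t. 0 < t \<Longrightarrow> t \<le> 1 \<Longrightarrow> 0 \<le> t * a + t\<^sup>2 * b"
  shows "0 \<le> a"
proof -
  have "0 \<le> a + t * b" if "t \<in> {0<..1}" for t
  proof -
    have "0 \<le> t * (a + t * b)" using assms[of t] that by (simp add: algebra_simps power2_eq_square)
    then show ?thesis using that by (simp add: zero_le_mult_iff)
  qed
  then have "eventually (\<lambda>t. 0 \<le> a + t * b) (at_right 0)"
    unfolding eventually_at_right_field by (intro exI[of _ 1]) auto
  moreover have "((\<lambda>t. a + t * b) \<longlongrightarrow> a + 0 * b) (at_right 0)" by (intro tendsto_intros)
  ultimately show ?thesis using tendsto_lowerbound[of "\<lambda>t. a + t * b" "a + 0 * b" "at_right 0" 0] by simp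
qed

text \<open>A minimizer u of d plus a multiple of the squared distance to x (a Moreau-Yosida
regularization) is a subgradient point, with a multiple of x - u as subgradient, and a large
multiple forces u close to x.\<close>
lemma subgrad_points_dense:
  fixes d :: "'a::euclidean_space \<Rightarrow> real"
  assumes D: "closed D" and cont: "continuous_on D d" and conv: "convex_on D d"
    and nonneg: "\<And>u. u \<in> D \<Longrightarrow> 0 \<le> d u" and x: "x \<in> D" and e: "0 < e"
  shows "\<exists>u\<in>subgrad_points D d. dist x u \<le> e"
proof -
  \<comment> \<open>large enough for the penalty outside the ball to exceed d x\<close>
  define c where "c = 2 * (d x + 1) / e\<^sup>2"
  have c: "c > 0" "c / 2 * e\<^sup>2 > d x" using nonneg[OF x] e by (auto simp: c_def field_simps)
  define \<phi> where "\<phi> u = d u + c / 2 * (norm (u - x))\<^sup>2" for u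
  have "continuous_on (D \<inter> cball x e) \<phi>" unfolding \<phi>_def
    by (intro continuous_intros continuous_on_subset[OF cont]) auto
  moreover have "compact (D \<inter> cball x e)" using D by (simp add: closed_Int_compact)
  moreover have "x \<in> D \<inter> cball x e" using x e by auto
  ultimately obtain u where u: "u \<in> D \<inter> cball x e" and umin: "\<And>v. v \<in> D \<inter> cball x e \<Longrightarrow> \<phi> u \<le> \<phi> v"
    using continuous_attains_inf[of "D \<inter> cball x e" \<phi>] by blast
  have glob: "\<phi> u \<le> \<phi> v" if "v \<in> D" for v
  proof (cases "v \<in> cball x e")
    case False
    then have "e\<^sup>2 \<le> (norm (v - x))\<^sup>2" using e by (auto simp: dist_norm norm_minus_commute)
    then have "c / 2 * e\<^sup>2 \<le> c / 2 * (norm (v - x))\<^sup>2" using c(1) by (intro mult_left_mono) auto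
    then have "\<phi> x \<le> \<phi> v" using c(2) nonneg[OF that] unfolding \<phi>_def by simp
    then show ?thesis using umin[OF \<open>x \<in> D \<inter> cball x e\<close>] by simp
  qed (use umin that in auto)
  have "d y \<ge> d u + (c *\<^sub>R (x - u)) \<bullet> (y - u)" if y: "y \<in> D" for y
  proof -
    have "0 \<le> d y - d u - (c *\<^sub>R (x - u)) \<bullet> (y - u)"
    proof (rule nonneg_if_quadratic_nonneg[where b = "c / 2 * (norm (y - u))\<^sup>2"])
      fix t :: real assume t: "0 < t" "t \<le> 1"
      define v where "v = (1 - t) *\<^sub>R u + t *\<^sub>R y"
      have "v \<in> D" unfolding v_def
        using conv u y t by (auto simp: convex_on_def intro!: convexD)
      moreover have "d v \<le> (1 - t) * d u + t * d y" unfolding v_def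
        using conv u y t unfolding convex_on_def by auto
      moreover have "(norm (v - x))\<^sup>2 = (norm (u - x))\<^sup>2 + 2 * t * ((u - x) \<bullet> (y - u)) + t\<^sup>2 * (norm (y - u))\<^sup>2"
        unfolding v_def power2_norm_eq_inner by (simp add: algebra_simps power2_eq_square inner_commute)
      moreover have "0 \<le> d v - d u + c / 2 * ((norm (v - x))\<^sup>2 - (norm (u - x))\<^sup>2)"
        using glob[OF \<open>v \<in> D\<close>] unfolding \<phi>_def right_diff_distrib by linarith
      ultimately have "0 \<le> (1 - t) * d u + t * d y - d u
          + c / 2 * (2 * t * ((u - x) \<bullet> (y - u)) + t\<^sup>2 * (norm (y - u))\<^sup>2)"
        by simp
      then show "0 \<le> t * (d y - d u - (c *\<^sub>R (x - u)) \<bullet> (y - u)) + t\<^sup>2 * (c / 2 * (norm (y - u))\<^sup>2)"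
        by (simp add: algebra_simps)
    qed
    then show ?thesis by simp
  qed
  then have "u \<in> subgrad_points D d" using u unfolding subgrad_points_def subdifferential_def by blast
  then show ?thesis using u by auto
qed

text \<open>A convex function may lack subgradients on the boundary of its domain because they
blow up there. Here they cannot: the upper bound on the Bregman divergence, tested at a relative
interior point z0, together with the subgradient inequality on a ball around z0, bounds the component of
gd along the affine hull of D. Subgradients at nearby points therefore accumulate, and the limit is a
subgradient. Only the component along the affine hull is bounded, which is why gd is projected.\<close>
lemma subgrad_points_eq_domain:
  fixes d :: "'a::euclidean_space \<Rightarrow> real"
  assumes n: "is_norm nE" and D: "closed D" and cont: "continuous_on D d" and conv: "convex_on D d"
    and nonneg: "\<And>u. u \<in> D \<Longrightarrow> 0 \<le> d u"
    and sel: "\<And>x. x \<in> subgrad_points D d \<Longrightarrow> gd x \<in> subdifferential D d x"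
    and breg: "\<And>x z. x \<in> D \<Longrightarrow> z \<in> subgrad_points D d \<Longrightarrow> bregman d gd z x \<le> \<Omega> / 2 * (nE (x - z))\<^sup>2"
  shows "subgrad_points D d = D"
proof
  show "D \<subseteq> subgrad_points D d"
  proof
    fix x assume x: "x \<in> D"
    have "convex D" using conv by (simp add: convex_on_def)
    then obtain z0 where "z0 \<in> rel_interior D" using x rel_interior_eq_empty by blast
    then obtain \<rho> where \<rho>: "\<rho> > 0" "cball z0 \<rho> \<inter> affine hull D \<subseteq> D" and z0: "z0 \<in> D"
      unfolding mem_rel_interior_cball by blast
    \<comment> \<open>the direction space of the affine hull, and q the projection of gd to it\<close>
    define S where "S = span ((\<lambda>v. v - z0) ` D)"
    have S_diff: "v - w \<in> S" if "v \<in> D" "w \<in> D" for v w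
    proof -
      have "(v - z0) - (w - z0) \<in> S" unfolding S_def using that by (intro span_diff span_base) auto
      then show ?thesis by simp
    qed
    have S_aff: "z0 + s \<in> affine hull D" if "s \<in> S" for s
    proof -
      have "affine hull D = (\<lambda>x. z0 + x) ` span ((\<lambda>x. x - z0) ` D)"
        using affine_hull_span_gen[of z0 D] z0 by (simp add: hull_inc)
      then show ?thesis using that unfolding S_def by blast
    qed
    have ball_D: "z0 + s \<in> D" if "s \<in> S" "norm s \<le> \<rho>" for s
      using \<rho>(2) S_aff[OF that(1)] that(2) by (auto simp: dist_norm)
    have "\<exists>u\<in>subgrad_points D d. dist x u \<le> 1 / real (Suc n)" for n
      by (rule subgrad_points_dense[OF D cont conv nonneg x]) auto
    then obtain u where u: "\<And>n. u n \<in> subgrad_points D d" and du: "\<And>n. dist x (u n) \<le> 1 / real (Suc n)"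
      by metis
    have uD: "u n \<in> D" for n using u[of n] unfolding subgrad_points_def by auto
    have ulim: "u \<longlonglongrightarrow> x"
    proof -
      have "(\<lambda>n. dist (u n) x) \<longlonglongrightarrow> 0"
      proof (rule tendsto_sandwich[of "\<lambda>_. 0" _ _ "\<lambda>n. 1 / real (Suc n)"])
        show "(\<lambda>n. 1 / real (Suc n)) \<longlonglongrightarrow> 0" using LIMSEQ_inverse_real_of_nat by (simp add: inverse_eq_divide)
      qed (use du in \<open>auto simp: dist_commute\<close>)
      then show ?thesis using tendsto_dist_iff by blast
    qed
    have "\<exists>q. q \<in> S \<and> (\<forall>s\<in>S. (gd (u n) - q) \<bullet> s = 0)" for n
    proof -
      obtain y z where "y \<in> span ((\<lambda>v. v - z0) ` D)" "\<And>w. w \<in> span ((\<lambda>v. v - z0) ` D) \<Longrightarrow> orthogonal z w"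
        "gd (u n) = y + z" using orthogonal_subspace_decomp_exists[of "(\<lambda>v. v - z0) ` D" "gd (u n)"] by metis
      then show ?thesis unfolding S_def by (intro exI[of _ y]) (auto simp: orthogonal_def)
    qed
    then obtain q where qS: "\<And>n. q n \<in> S" and q: "\<And>n s. s \<in> S \<Longrightarrow> gd (u n) \<bullet> s = q n \<bullet> s"
      by (metis eq_iff_diff_eq_0 inner_diff_left)
    have qsub: "d y \<ge> d (u n) + q n \<bullet> (y - u n)" if "y \<in> D" for y n
      using sel[OF u[of n]] that q[OF S_diff[OF that uD[of n]]] unfolding subdifferential_def by auto
    have qup: "d z0 - d (u n) - q n \<bullet> (z0 - u n) \<le> \<Omega> / 2 * (nE (z0 - u n))\<^sup>2" for n
      using breg[OF z0 u[of n]] q[OF S_diff[OF z0 uD[of n]]] unfolding bregman_def by auto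
    obtain B1 where B1: "\<And>v. v \<in> D \<inter> cball z0 \<rho> \<Longrightarrow> d v \<le> B1"
    proof -
      have "compact (d ` (D \<inter> cball z0 \<rho>))"
        using D by (intro compact_continuous_image continuous_on_subset[OF cont]) (auto simp: closed_Int_compact)
      then have "bdd_above (d ` (D \<inter> cball z0 \<rho>))" by (intro bounded_imp_bdd_above compact_imp_bounded)
      then obtain B where "\<forall>w\<in>d ` (D \<inter> cball z0 \<rho>). w \<le> B"
        unfolding bdd_above_def by blast
      then show ?thesis using that[of B] by (meson imageI)
    qed
    have "convergent (\<lambda>n. \<Omega> / 2 * (nE (z0 - u n))\<^sup>2)"
    proof -
      have "isCont nE (z0 - x)"
        using is_norm_continuous[OF n, of UNIV] by (simp add: continuous_on_eq_continuous_at)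
      then have lim: "(\<lambda>n. nE (z0 - u n)) \<longlonglongrightarrow> nE (z0 - x)"
        by (rule isCont_tendsto_compose) (intro tendsto_intros ulim)
      show ?thesis
        by (rule convergentI[of _ "\<Omega> / 2 * (nE (z0 - x))\<^sup>2"]) (intro tendsto_intros lim)
    qed
    then have "Bseq (\<lambda>n. \<Omega> / 2 * (nE (z0 - u n))\<^sup>2)" by (rule convergent_imp_Bseq)
    then obtain B2 where "\<forall>n. norm (\<Omega> / 2 * (nE (z0 - u n))\<^sup>2) \<le> B2" by (rule BseqE)
    then have B2: "\<Omega> / 2 * (nE (z0 - u n))\<^sup>2 \<le> B2" for n
      unfolding real_norm_def by (meson abs_le_D1)
    have "norm (q n) \<le> (B1 - d z0 + B2) / \<rho>" for n
    proof (cases "q n = 0")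
      case True
      have "z0 \<in> D \<inter> cball z0 \<rho>" using z0 \<rho>(1) by auto
      moreover have "0 \<le> B2" using qup[of n] qsub[OF z0, of n] B2[of n] by linarith
      ultimately show ?thesis using B1[of z0] \<rho>(1) True by simp
    next
      case False
      \<comment> \<open>the point of the ball around z0 at which q n is largest\<close>
      let ?s = "(\<rho> / norm (q n)) *\<^sub>R q n"
      have s: "?s \<in> S" unfolding S_def using qS[of n] unfolding S_def by (rule span_scale)
      have ns: "norm ?s = \<rho>" using \<rho>(1) False by simp
      have D1: "z0 + ?s \<in> D" using ball_D[OF s] ns by simp
      have "d (z0 + ?s) \<le> B1" using B1[of "z0 + ?s"] D1 ns by (simp add: dist_norm)
      moreover have "d (z0 + ?s) \<ge> d (u n) + q n \<bullet> (z0 - u n) + q n \<bullet> ?s"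
        using qsub[OF D1, of n] by (simp add: algebra_simps)
      moreover have "q n \<bullet> ?s = \<rho> * norm (q n)" using False
        by (simp add: power2_norm_eq_inner[symmetric] power2_eq_square)
      ultimately have "\<rho> * norm (q n) \<le> B1 - d z0 + B2" using qup[of n] B2[of n] by linarith
      then show ?thesis using \<rho>(1) by (simp add: field_simps)
    qed
    then have "bounded (range q)" unfolding bounded_iff by blast
    then obtain l r where r: "strict_mono (r :: nat \<Rightarrow> nat)" and l: "(q \<circ> r) \<longlonglongrightarrow> l"
      using bounded_imp_convergent_subsequence by blast
    have ur: "(\<lambda>n. u (r n)) \<longlonglongrightarrow> x" using LIMSEQ_subseq_LIMSEQ[OF ulim r] by (simp add: o_def)
    have dur: "(\<lambda>n. d (u (r n))) \<longlonglongrightarrow> d x"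
      by (rule continuous_on_tendsto_compose[OF cont ur x]) (simp add: uD)
    have "d y \<ge> d x + l \<bullet> (y - x)" if "y \<in> D" for y
    proof (rule tendsto_upperbound)
      show "(\<lambda>n. d (u (r n)) + (q \<circ> r) n \<bullet> (y - u (r n))) \<longlonglongrightarrow> d x + l \<bullet> (y - x)"
        by (intro tendsto_intros dur l ur)
    qed (use qsub[OF that] in auto)
    then show "x \<in> subgrad_points D d" using x unfolding subgrad_points_def subdifferential_def by blast
  qed
qed (auto simp: subgrad_points_def)

section \<open>The mirror step\<close>

text \<open>The prox-function after its subdifferentiability is settled: both bounds on the Bregman
divergence hold on all of D, with the one selection gd.\<close>
locale smooth_prox =
  fixes nE :: "'a::euclidean_space \<Rightarrow> real" and D :: "'a set" and d :: "'a \<Rightarrow> real"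
    and gd :: "'a \<Rightarrow> 'a" and \<Omega> :: real
  assumes norm: "is_norm nE"
    and d_cont: "continuous_on D d" and gd_cont: "continuous_on D gd"
    and strong: "\<And>x z. x \<in> D \<Longrightarrow> z \<in> D \<Longrightarrow> 1 / 2 * (nE (x - z))\<^sup>2 \<le> bregman d gd z x"
    and smooth: "\<And>x z. x \<in> D \<Longrightarrow> z \<in> D \<Longrightarrow> bregman d gd z x \<le> \<Omega> / 2 * (nE (x - z))\<^sup>2"
    and zero_min: "\<And>x. x \<in> D \<Longrightarrow> d 0 \<le> d x"

lemma smooth_prox_if_prox_function:
  assumes n: "is_norm nE" and prox: "prox_function nE D d gd"
    and breg: "\<And>x z. x \<in> D \<Longrightarrow> z \<in> subgrad_points D d \<Longrightarrow> bregman d gd z x \<le> \<Omega> / 2 * (nE (x - z))\<^sup>2"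
  shows "smooth_prox nE D d gd \<Omega>"
proof -
  have zero: "0 \<in> D" "\<And>x. x \<in> D \<Longrightarrow> d 0 \<le> d x" "d 0 = 0"
    using prox unfolding prox_function_def is_arg_min_def by (auto simp: not_less)
  have cl: "closed D" "continuous_on D d" "convex_on D d"
    using prox unfolding prox_function_def by auto
  have eq: "subgrad_points D d = D"
  proof (rule subgrad_points_eq_domain[OF n cl])
    show "0 \<le> d u" if "u \<in> D" for u using zero that by metis
    show "gd x \<in> subdifferential D d x" if "x \<in> subgrad_points D d" for x
      using prox that unfolding prox_function_def by blast
  qed (use breg in auto)
  show ?thesis
  proof
    show "continuous_on D gd" using prox eq unfolding prox_function_def by auto
    show "1 / 2 * (nE (x - z))\<^sup>2 \<le> bregman d gd z x" if "x \<in> D" "z \<in> D" for x z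
      using prox that eq unfolding prox_function_def bregman_def by blast
    show "bregman d gd z x \<le> \<Omega> / 2 * (nE (x - z))\<^sup>2" if "x \<in> D" "z \<in> D" for x z
      using breg that eq by blast
  qed (use n cl zero in auto)
qed

text \<open>Convergence of minimizers is obtained from here: by compactness it suffices to identify the limits
of convergent subsequences.\<close>
lemma tendsto_if_subseq_limits_eq:
  fixes u :: "nat \<Rightarrow> 'b::metric_space"
  assumes K: "compact K" "\<And>n. u n \<in> K"
    and lim: "\<And>r l. strict_mono r \<Longrightarrow> (\<lambda>n. u (r n)) \<longlonglongrightarrow> l \<Longrightarrow> l = a"
  shows "u \<longlonglongrightarrow> a"
proof (rule ccontr)
  assume "\<not> u \<longlonglongrightarrow> a"
  then obtain e where e: "e > 0" "\<And>N. \<exists>n\<ge>N. e \<le> dist (u n) a"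
    unfolding lim_sequentially by (auto simp: not_less)
  then have "infinite {n. e \<le> dist (u n) a}" unfolding infinite_nat_iff_unbounded_le by auto
  then obtain r :: "nat \<Rightarrow> nat" where r: "strict_mono r" "\<And>n. e \<le> dist (u (r n)) a"
    using infinite_enumerate by (metis mem_Collect_eq)
  have "\<forall>n. (u \<circ> r) n \<in> K" using K(2) by auto
  then obtain l s where s: "strict_mono (s :: nat \<Rightarrow> nat)" "(u \<circ> r \<circ> s) \<longlonglongrightarrow> l"
    using K(1) unfolding compact_def by metis
  have "l = a" by (rule lim[of "r \<circ> s"]) (use r s in \<open>auto simp: o_def strict_mono_def\<close>)
  then have "(\<lambda>n. dist (u (r (s n))) a) \<longlonglongrightarrow> dist a a"
    using s(2) by (intro tendsto_intros) (simp add: o_def)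
  then have "e \<le> dist a a" by (rule tendsto_lowerbound) (use r in auto)
  then show False using e by simp
qed

lemma is_arg_min_arg_min_on: "is_arg_min f (\<lambda>x. x \<in> S) a \<Longrightarrow> is_arg_min f (\<lambda>x. x \<in> S) (arg_min_on f S)"
  unfolding arg_min_on_def arg_min_def by (rule someI)

text \<open>The geometry of a single stage of radius r. The center y is a parameter of all
notions below and not of the locale, since measurability of the run requires y to vary.\<close>
locale prox_stage = smooth_prox nE D d gd \<Omega>
  for nE :: "'a::euclidean_space \<Rightarrow> real" and D d gd \<Omega> +
  fixes X :: "'a set" and r :: real
  assumes X_closed: "closed X" and X_convex: "convex X" and r_pos: "0 < r"
    and rescaled: "\<And>x y. x \<in> X \<Longrightarrow> y \<in> X \<Longrightarrow> nE (x - y) \<le> r \<Longrightarrow> (1 / r) *\<^sub>R (x - y) \<in> D"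
begin

definition Q :: "'a \<Rightarrow> 'a set" where "Q y = {x \<in> X. (nE (x - y))\<^sup>2 \<le> r\<^sup>2}"
definition dr :: "'a \<Rightarrow> 'a \<Rightarrow> real" where "dr y x = d ((1 / r) *\<^sub>R (x - y))"
definition gr :: "'a \<Rightarrow> 'a \<Rightarrow> 'a" where "gr y x = (1 / r) *\<^sub>R gd ((1 / r) *\<^sub>R (x - y))"
definition obj :: "'a \<Rightarrow> 'a \<Rightarrow> 'a \<Rightarrow> real" where "obj y q u = q \<bullet> u + dr y u"
definition step :: "'a \<Rightarrow> 'a \<Rightarrow> 'a" where "step y q = arg_min_on (obj y q) (Q y)"

abbreviation V :: "'a \<Rightarrow> 'a \<Rightarrow> 'a \<Rightarrow> real" where "V y z x \<equiv> bregman (dr y) (gr y) z x"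

lemma Q_iff: "x \<in> Q y \<longleftrightarrow> x \<in> X \<and> nE (x - y) \<le> r"
  unfolding Q_def using abs_le_square_iff[of "nE (x - y)" r] is_norm_nonneg[OF norm, of "x - y"] r_pos
  by auto

lemma Q_eq: "Q y = {x \<in> X. nE (x - y) \<le> r}" by (auto simp: Q_iff)

lemma center_in_Q: "y \<in> X \<Longrightarrow> y \<in> Q y"
  using r_pos by (simp add: Q_iff is_norm_zero[OF norm])

lemma compact_Q: "compact (Q y)"
  unfolding Q_eq by (rule compact_norm_ball[OF norm X_closed])

lemma convex_Q: "convex (Q y)"
  unfolding convex_alt
proof (intro ballI allI impI)
  fix a b and t :: real assume a: "a \<in> Q y" "b \<in> Q y" and t: "0 \<le> t \<and> t \<le> 1"
  let ?c = "(1 - t) *\<^sub>R a + t *\<^sub>R b"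
  have "?c - y = (1 - t) *\<^sub>R (a - y) + t *\<^sub>R (b - y)" by (simp add: algebra_simps)
  then have "nE (?c - y) \<le> (1 - t) * nE (a - y) + t * nE (b - y)"
    using is_norm_triangle[OF norm, of "(1 - t) *\<^sub>R (a - y)" "t *\<^sub>R (b - y)"] t
    by (simp add: is_norm_scaleR[OF norm])
  also have "\<dots> \<le> (1 - t) * r + t * r" using a t by (intro add_mono mult_left_mono) (auto simp: Q_iff)
  finally have "nE (?c - y) \<le> r" by (simp add: algebra_simps)
  moreover have "?c \<in> X" using X_convex a t unfolding convex_alt Q_iff by blast
  ultimately show "?c \<in> Q y" by (simp add: Q_iff)
qed

lemma scaled_in_D: "y \<in> X \<Longrightarrow> x \<in> Q y \<Longrightarrow> (1 / r) *\<^sub>R (x - y) \<in> D"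
  using rescaled by (auto simp: Q_iff)

lemma V_rescaled: "V y z x = bregman d gd ((1 / r) *\<^sub>R (z - y)) ((1 / r) *\<^sub>R (x - y))"
proof -
  have "(1 / r) *\<^sub>R (x - y) - (1 / r) *\<^sub>R (z - y) = (1 / r) *\<^sub>R (x - z)" by (simp add: algebra_simps)
  then show ?thesis unfolding bregman_def dr_def gr_def by simp
qed

lemma nE_rescaled: "nE ((1 / r) *\<^sub>R (x - y) - (1 / r) *\<^sub>R (z - y)) = nE (x - z) / r"
proof -
  have "(1 / r) *\<^sub>R (x - y) - (1 / r) *\<^sub>R (z - y) = (1 / r) *\<^sub>R (x - z)" by (simp add: algebra_simps)
  then show ?thesis using r_pos by (simp add: is_norm_scaleR[OF norm])
qed

lemma V_lower: "y \<in> X \<Longrightarrow> x \<in> Q y \<Longrightarrow> z \<in> Q y \<Longrightarrow> 1 / 2 * (nE (x - z) / r)\<^sup>2 \<le> V y z x"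
  using strong[OF scaled_in_D scaled_in_D, of y x y z] unfolding V_rescaled nE_rescaled by blast

lemma V_upper: "y \<in> X \<Longrightarrow> x \<in> Q y \<Longrightarrow> z \<in> Q y \<Longrightarrow> V y z x \<le> \<Omega> / 2 * (nE (x - z) / r)\<^sup>2"
  using smooth[OF scaled_in_D scaled_in_D, of y x y z] unfolding V_rescaled nE_rescaled by blast

lemma V_nonneg: "y \<in> X \<Longrightarrow> x \<in> Q y \<Longrightarrow> z \<in> Q y \<Longrightarrow> 0 \<le> V y z x"
  using V_lower[of y x z] by (smt (verit) zero_le_power2 mult_nonneg_nonneg divide_nonneg_nonneg)

lemma continuous_on_dr: "y \<in> X \<Longrightarrow> continuous_on (Q y) (dr y)"
  unfolding dr_def
  by (rule continuous_on_compose2[OF d_cont]) (auto intro!: continuous_intros scaled_in_D)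

text \<open>Uniqueness of minimizers comes from this gain at the midpoint, which is strong convexity of the
rescaled prox-function.\<close>
lemma obj_midpoint:
  assumes y: "y \<in> X" and u: "u \<in> Q y" and v: "v \<in> Q y"
  shows "(1/2) *\<^sub>R (u + v) \<in> Q y"
    "2 * obj y q ((1/2) *\<^sub>R (u + v)) + 1 / 4 * (nE (u - v) / r)\<^sup>2 \<le> obj y q u + obj y q v"
proof -
  let ?m = "(1/2) *\<^sub>R (u + v)"
  show m: "?m \<in> Q y" using convexD[OF convex_Q u v, of "1/2" "1/2"] by (simp add: scaleR_right_distrib)
  have e: "u - ?m = (1/2) *\<^sub>R (u - v)" "v - ?m = (-1/2) *\<^sub>R (u - v)"
    by (simp_all add: algebra_simps flip: scaleR_left_distrib)
  define K where "K = (nE (u - v) / r)\<^sup>2"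
  have K: "1 / 2 * (nE (u - v) / (2 * r))\<^sup>2 = K / 8" by (simp add: K_def power_divide)
  have "dr y u \<ge> dr y ?m + gr y ?m \<bullet> (u - ?m) + K / 8"
    using V_lower[OF y u m] K unfolding bregman_def e(1) is_norm_scaleR[OF norm] by simp
  moreover have "dr y v \<ge> dr y ?m + gr y ?m \<bullet> (v - ?m) + K / 8"
    using V_lower[OF y v m] K unfolding bregman_def e(2) is_norm_scaleR[OF norm] by simp
  moreover have "gr y ?m \<bullet> (u - ?m) + gr y ?m \<bullet> (v - ?m) = 0" unfolding e by simp
  moreover have "2 * (q \<bullet> ?m) = q \<bullet> u + q \<bullet> v" by (simp add: inner_add_right)
  ultimately have "2 * (q \<bullet> ?m + dr y ?m) + 1 / 4 * K \<le> q \<bullet> u + dr y u + (q \<bullet> v + dr y v)" by argo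
  then show "2 * obj y q ?m + 1 / 4 * (nE (u - v) / r)\<^sup>2 \<le> obj y q u + obj y q v"
    unfolding obj_def K_def .
qed

lemma step_min:
  assumes y: "y \<in> X"
  shows "step y q \<in> Q y" "\<And>u. u \<in> Q y \<Longrightarrow> obj y q (step y q) \<le> obj y q u"
proof -
  have "continuous_on (Q y) (obj y q)"
    unfolding obj_def by (intro continuous_intros continuous_on_dr[OF y])
  then obtain a where "a \<in> Q y" "\<forall>u\<in>Q y. obj y q a \<le> obj y q u"
    using continuous_attains_inf[OF compact_Q] center_in_Q[OF y] by blast
  then have "is_arg_min (obj y q) (\<lambda>x. x \<in> Q y) a" unfolding is_arg_min_def by (auto simp: not_less)
  then have "is_arg_min (obj y q) (\<lambda>x. x \<in> Q y) (step y q)"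
    unfolding step_def by (rule is_arg_min_arg_min_on)
  then show "step y q \<in> Q y" "\<And>u. u \<in> Q y \<Longrightarrow> obj y q (step y q) \<le> obj y q u"
    unfolding is_arg_min_def by (auto simp: not_less)
qed

lemma step_unique:
  assumes y: "y \<in> X" and u: "u \<in> Q y" and le: "obj y q u \<le> obj y q (step y q)"
  shows "u = step y q"
proof -
  let ?s = "step y q"
  have "obj y q ?s \<le> obj y q ((1/2) *\<^sub>R (u + ?s))" 
    by (rule step_min(2)[OF y obj_midpoint(1)[OF y u step_min(1)[OF y]]])
  then have "1 / 4 * (nE (u - ?s) / r)\<^sup>2 \<le> 0"
    using obj_midpoint(2)[OF y u step_min(1)[OF y, of q], of q] le by linarith
  then have "nE (u - ?s) = 0" using r_pos by (simp add: power_le_zero_eq)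
  then show ?thesis using is_norm_eq_0[OF norm] by simp
qed

lemma step_zero: "y \<in> X \<Longrightarrow> step y 0 = y"
  using step_unique[of y y 0] step_min(1)[of y 0] center_in_Q[of y] zero_min[OF scaled_in_D]
  unfolding obj_def dr_def by simp

text \<open>The rescaled prox-function is minimal at the center, since d is minimal at 0; so a stage starts where
the previous one ended.\<close>
lemma first_iterate: "y \<in> X \<Longrightarrow> arg_min_on (dr y) (Q y) = y"
  using step_zero[of y] unfolding step_def obj_def by simp

text \<open>All dependence on the current point and on the subgradient is through one dual variable.\<close>
lemma mirr_eq_step: "mirr (Q y) (dr y) (gr y) x p = step y (p - gr y x)"
  unfolding mirr_def step_def obj_def by (simp add: inner_diff_left algebra_simps)

text \<open>Berge's maximum theorem for the moving feasible set Q y. Limits of points of Q (ys n) lie in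
Q y because X is closed. Conversely every point of Q y is a limit of points of Q (ys n): move it
slightly towards ys n. Hence a limit of minimizers is a minimizer, and this one is unique.\<close>
lemma continuous_on_step: "continuous_on (X \<times> UNIV) (\<lambda>(y, q). step y q)"
  unfolding continuous_on_sequentially
proof (intro allI ballI impI, elim conjE)
  fix w :: "nat \<Rightarrow> 'a \<times> 'a" and a :: "'a \<times> 'a"
  assume a: "a \<in> X \<times> UNIV" and w: "\<forall>n. w n \<in> X \<times> UNIV" and wa: "w \<longlonglongrightarrow> a"
  define ys qs y q where "ys n = fst (w n)" and "qs n = snd (w n)" and "y = fst a" and "q = snd a" for n
  have y: "y \<in> X" and ys: "ys n \<in> X" for n using a w by (auto simp: y_def ys_def mem_Times_iff)
  have lim: "ys \<longlonglongrightarrow> y" "qs \<longlonglongrightarrow> q" unfolding ys_def qs_def y_def q_def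
    by (intro tendsto_fst tendsto_snd wa)+
  have nlim: "(\<lambda>n. nE (ys n - y)) \<longlonglongrightarrow> 0"
  proof -
    have "isCont nE 0" using is_norm_continuous[OF norm, of UNIV] by (simp add: continuous_on_eq_continuous_at)
    moreover have "(\<lambda>n. ys n - y) \<longlonglongrightarrow> 0" using tendsto_diff[OF lim(1) tendsto_const[of y]] by simp
    ultimately have "(\<lambda>n. nE (ys n - y)) \<longlonglongrightarrow> nE 0" by (rule isCont_tendsto_compose)
    then show ?thesis by (simp add: is_norm_zero[OF norm])
  qed
  let ?u = "\<lambda>n. step (ys n) (qs n)"
  let ?s = "step y q"
  have uQ: "?u n \<in> Q (ys n)" for n by (rule step_min(1)[OF ys])
  have "Bseq (\<lambda>n. nE (ys n - y))" using convergentI[OF nlim] by (rule convergent_imp_Bseq)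
  then obtain C where "\<forall>n. norm (nE (ys n - y)) \<le> C" by (rule BseqE)
  then have C: "nE (ys n - y) \<le> C" for n unfolding real_norm_def by (meson abs_le_D1)
  have "?u \<longlonglongrightarrow> ?s"
  proof (rule tendsto_if_subseq_limits_eq)
    show "compact {x \<in> X. nE (x - y) \<le> r + C}" by (rule compact_norm_ball[OF norm X_closed])
    show "?u n \<in> {x \<in> X. nE (x - y) \<le> r + C}" for n
      using uQ[of n] C[of n] is_norm_triangle[OF norm, of "?u n - ys n" "ys n - y"] by (auto simp: Q_iff)
    fix s l assume s: "strict_mono (s :: nat \<Rightarrow> nat)" and l: "(\<lambda>n. ?u (s n)) \<longlonglongrightarrow> l"
    have ysl: "(\<lambda>n. ys (s n)) \<longlonglongrightarrow> y" and qsl: "(\<lambda>n. qs (s n)) \<longlonglongrightarrow> q"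
      and nsl: "(\<lambda>n. nE (ys (s n) - y)) \<longlonglongrightarrow> 0"
      using LIMSEQ_subseq_LIMSEQ[OF lim(1) s] LIMSEQ_subseq_LIMSEQ[OF lim(2) s]
        LIMSEQ_subseq_LIMSEQ[OF nlim s] by (simp_all add: o_def)
    have lX: "l \<in> X"
      by (rule closed_sequentially[OF X_closed _ l]) (use uQ in \<open>auto simp: Q_iff\<close>)
    have lQ: "l \<in> Q y"
    proof -
      have "isCont nE (l - y)" using is_norm_continuous[OF norm, of UNIV] by (simp add: continuous_on_eq_continuous_at)
      then have "(\<lambda>n. nE (?u (s n) - ys (s n))) \<longlonglongrightarrow> nE (l - y)"
        by (rule isCont_tendsto_compose) (intro tendsto_intros l ysl)
      then have "nE (l - y) \<le> r" by (rule tendsto_upperbound) (use uQ in \<open>auto simp: Q_iff\<close>)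
      then show ?thesis using lX by (simp add: Q_iff)
    qed
    \<comment> \<open>shifted by this fraction towards ys, every point of Q y lies in the ball around ys\<close>
    define t v where "t n = nE (ys (s n) - y) / (r + nE (ys (s n) - y))"
      and "v n = (1 - t n) *\<^sub>R ?s + t n *\<^sub>R ys (s n)" for n
    have t: "0 \<le> t n" "t n \<le> 1" for n
      unfolding t_def using is_norm_nonneg[OF norm, of "ys (s n) - y"] r_pos by auto
    have sQ: "?s \<in> Q y" by (rule step_min(1)[OF y])
    have vQ: "v n \<in> Q (ys (s n))" for n
    proof -
      have pos: "r + nE (ys (s n) - y) > 0" using is_norm_nonneg[OF norm, of "ys (s n) - y"] r_pos by auto
      have "v n - ys (s n) = (1 - t n) *\<^sub>R (?s - ys (s n))" unfolding v_def by (simp add: algebra_simps)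
      then have "nE (v n - ys (s n)) = (1 - t n) * nE (?s - ys (s n))"
        using t[of n] by (simp add: is_norm_scaleR[OF norm])
      also have "\<dots> \<le> (1 - t n) * (r + nE (ys (s n) - y))"
        using t[of n] sQ is_norm_triangle[OF norm, of "?s - y" "y - ys (s n)"]
          is_norm_minus_commute[OF norm, of y "ys (s n)"]
        by (intro mult_left_mono) (auto simp: Q_iff)
      also have "\<dots> = r" unfolding t_def using pos by (simp add: field_simps)
      finally have "nE (v n - ys (s n)) \<le> r" .
      moreover have "v n \<in> X" unfolding v_def
        using X_convex sQ ys t[of n] unfolding convex_alt Q_iff by blast
      ultimately show ?thesis by (simp add: Q_iff)
    qed
    have "t \<longlonglongrightarrow> 0 / (r + 0)" unfolding t_def by (intro tendsto_intros nsl) (use r_pos in auto)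
    then have t0: "t \<longlonglongrightarrow> 0" by simp
    have "v \<longlonglongrightarrow> (1 - 0) *\<^sub>R ?s + 0 *\<^sub>R y" unfolding v_def by (intro tendsto_intros ysl t0)
    then have v: "v \<longlonglongrightarrow> ?s" by simp
    have obj_lim: "(\<lambda>n. obj (ys (s n)) (qs (s n)) (b n)) \<longlonglongrightarrow> obj y q \<beta>"
      if b: "b \<longlonglongrightarrow> \<beta>" "\<And>n. b n \<in> Q (ys (s n))" "\<beta> \<in> Q y" for b \<beta>
    proof -
      have "(\<lambda>n. d ((1 / r) *\<^sub>R (b n - ys (s n)))) \<longlonglongrightarrow> d ((1 / r) *\<^sub>R (\<beta> - y))"
        by (rule continuous_on_tendsto_compose[OF d_cont])
           (use scaled_in_D[OF ys b(2)] scaled_in_D[OF y b(3)] in \<open>auto intro!: tendsto_intros b ysl\<close>)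
      then show ?thesis unfolding obj_def dr_def by (intro tendsto_intros qsl b)
    qed
    have "obj y q l \<le> obj y q ?s"
    proof (rule tendsto_le[OF _ obj_lim[OF v vQ sQ] obj_lim[OF l uQ lQ]])
      show "\<forall>\<^sub>F n in sequentially. obj (ys (s n)) (qs (s n)) (?u (s n)) \<le> obj (ys (s n)) (qs (s n)) (v n)"
        by (intro always_eventually allI step_min(2)[OF ys vQ])
    qed simp
    then show "l = ?s" by (rule step_unique[OF y lQ])
  qed
  then show "((\<lambda>(y, q). step y q) \<circ> w) \<longlonglongrightarrow> (case a of (y, q) \<Rightarrow> step y q)"
    unfolding o_def case_prod_beta ys_def qs_def y_def q_def .
qed

text \<open>The optimality condition of the mirror step holds with the selected subgradient because the
upper bound on the Bregman divergence leaves only an error of second order along segments that start at the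
minimizer.\<close>
lemma step_optimality:
  assumes y: "y \<in> X" and u: "u \<in> Q y"
  shows "0 \<le> (q + gr y (step y q)) \<bullet> (u - step y q)"
proof -
  let ?s = "step y q"
  let ?b = "\<Omega> / 2 * (nE (u - ?s) / r)\<^sup>2"
  have s: "?s \<in> Q y" by (rule step_min(1)[OF y])
  show ?thesis
  proof (rule nonneg_if_quadratic_nonneg[where b = ?b])
    fix t :: real assume t: "0 < t" "t \<le> 1"
    define v where "v = (1 - t) *\<^sub>R ?s + t *\<^sub>R u"
    have v: "v \<in> Q y" unfolding v_def using convex_Q[of y] s u t unfolding convex_alt by auto
    have e: "v - ?s = t *\<^sub>R (u - ?s)" unfolding v_def by (simp add: algebra_simps)
    have "dr y v \<le> dr y ?s + gr y ?s \<bullet> (v - ?s) + \<Omega> / 2 * (nE (v - ?s) / r)\<^sup>2"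
      using V_upper[OF y v s] unfolding bregman_def by simp
    moreover have "obj y q ?s \<le> obj y q v" by (rule step_min(2)[OF y v])
    ultimately have "0 \<le> q \<bullet> (v - ?s) + gr y ?s \<bullet> (v - ?s) + \<Omega> / 2 * (nE (v - ?s) / r)\<^sup>2"
      unfolding obj_def by (simp add: inner_diff_right)
    then show "0 \<le> t * ((q + gr y ?s) \<bullet> (u - ?s)) + t\<^sup>2 * ?b"
      using t unfolding e is_norm_scaleR[OF norm]
      by (simp add: inner_add_left power_mult_distrib power_divide algebra_simps)
  qed
qed

text \<open>The three-point identity for Bregman divergences, with the loss
\<open>p \<bullet> (x - x')\<close> split by Young's inequality into the dual norm of p and a square that
strong convexity absorbs.\<close>
lemma mirror_step_bound:
  assumes y: "y \<in> X" and x: "x \<in> Q y" and u: "u \<in> Q y"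
    and G: "\<And>v. p \<bullet> v \<le> b * nE v"
  defines "x' \<equiv> mirr (Q y) (dr y) (gr y) x p"
  shows "p \<bullet> (x - u) \<le> b\<^sup>2 * r\<^sup>2 / 2 + V y x u - V y x' u"
proof -
  have x': "x' \<in> Q y" unfolding x'_def mirr_eq_step by (rule step_min(1)[OF y])
  have opt: "0 \<le> (p - gr y x + gr y x') \<bullet> (u - x')"
    unfolding x'_def mirr_eq_step using step_optimality[OF y u, of "p - gr y x"] by simp
  have young: "a * c \<le> a\<^sup>2 / 2 + c\<^sup>2 / 2" for a c :: real
    using sum_squares_bound[of a c] by simp
  have "p \<bullet> (x - x') \<le> b * nE (x - x')" by (rule G)
  also have "\<dots> = (b * r) * (nE (x - x') / r)" using r_pos by simp
  also have "\<dots> \<le> (b * r)\<^sup>2 / 2 + (nE (x - x') / r)\<^sup>2 / 2"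
    by (rule young)
  also have "(nE (x - x') / r)\<^sup>2 / 2 \<le> V y x x'"
    using V_lower[OF y x' x] by (simp add: is_norm_minus_commute[OF norm, of x x'])
  finally have "p \<bullet> (x - x') \<le> b\<^sup>2 * r\<^sup>2 / 2 + V y x x'" by (simp add: power_mult_distrib)
  moreover have "V y x u - V y x' u - V y x x' = (gr y x' - gr y x) \<bullet> (u - x')"
    unfolding bregman_def by (simp add: algebra_simps)
  ultimately show ?thesis using opt by (simp add: algebra_simps)
qed

text \<open>The divergences telescope.\<close>
lemma mirror_descent_regret:
  assumes y: "y \<in> X" and u: "u \<in> Q y" and h: "0 \<le> h"
    and start: "x 0 = y" and step: "\<And>k. x (Suc k) = mirr (Q y) (dr y) (gr y) (x k) (h *\<^sub>R G k)"
    and G: "\<And>k v. k < N \<Longrightarrow> G k \<bullet> v \<le> b * nE v"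
  shows "h * (\<Sum>k<N. G k \<bullet> (x k - u)) \<le> real N * (h\<^sup>2 * b\<^sup>2 * r\<^sup>2 / 2) + \<Omega> / 2 * (nE (u - y) / r)\<^sup>2"
proof -
  have xQ: "x k \<in> Q y" for k
  proof (cases k)
    case 0 then show ?thesis using start center_in_Q[OF y] by simp
  next
    case (Suc j) then show ?thesis unfolding Suc step mirr_eq_step using step_min(1)[OF y] by simp
  qed
  have "h * (\<Sum>k<n. G k \<bullet> (x k - u)) \<le> real n * (h\<^sup>2 * b\<^sup>2 * r\<^sup>2 / 2) + V y (x 0) u - V y (x n) u"
    if "n \<le> N" for n using that
  proof (induction n)
    case (Suc n)
    have "(h *\<^sub>R G n) \<bullet> v \<le> (h * b) * nE v" for v
      using mult_left_mono[OF G[of n v] h] Suc.prems by (simp add: mult.assoc)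
    then have "(h *\<^sub>R G n) \<bullet> (x n - u) \<le> (h * b)\<^sup>2 * r\<^sup>2 / 2 + V y (x n) u - V y (x (Suc n)) u"
      unfolding step by (rule mirror_step_bound[OF y xQ u])
    then have "h * (G n \<bullet> (x n - u)) \<le> h\<^sup>2 * b\<^sup>2 * r\<^sup>2 / 2 + V y (x n) u - V y (x (Suc n)) u"
      by (simp add: power_mult_distrib)
    moreover have "h * (\<Sum>k<n. G k \<bullet> (x k - u)) \<le> real n * (h\<^sup>2 * b\<^sup>2 * r\<^sup>2 / 2) + V y (x 0) u - V y (x n) u"
      using Suc by simp
    moreover have "real (Suc n) * (h\<^sup>2 * b\<^sup>2 * r\<^sup>2 / 2) = real n * (h\<^sup>2 * b\<^sup>2 * r\<^sup>2 / 2) + h\<^sup>2 * b\<^sup>2 * r\<^sup>2 / 2"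
      by (simp add: algebra_simps)
    ultimately show ?case unfolding sum.lessThan_Suc distrib_left by linarith
  qed simp
  from this[of N] have "h * (\<Sum>k<N. G k \<bullet> (x k - u)) \<le> real N * (h\<^sup>2 * b\<^sup>2 * r\<^sup>2 / 2) + V y (x 0) u - V y (x N) u" by simp
  moreover have "0 \<le> V y (x N) u" by (rule V_nonneg[OF y u xQ])
  moreover have "V y (x 0) u \<le> \<Omega> / 2 * (nE (u - y) / r)\<^sup>2" using V_upper[OF y u xQ[of 0]] start by simp
  ultimately show ?thesis by linarith
qed

end

section \<open>Strong convexity and one stage of mirror descent\<close>

lemma convex_on_average:
  assumes f: "convex_on C f" and I: "finite I" "I \<noteq> {}" and x: "\<And>i. i \<in> I \<Longrightarrow> x i \<in> C"
  shows "(1 / real (card I)) *\<^sub>R (\<Sum>i\<in>I. x i) \<in> C"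
    "f ((1 / real (card I)) *\<^sub>R (\<Sum>i\<in>I. x i)) \<le> (\<Sum>i\<in>I. f (x i)) / real (card I)"
proof -
  have s: "(\<Sum>i\<in>I. 1 / real (card I)) = 1" using I by simp
  have e: "(1 / real (card I)) *\<^sub>R (\<Sum>i\<in>I. x i) = (\<Sum>i\<in>I. (1 / real (card I)) *\<^sub>R x i)"
    by (rule scaleR_sum_right)
  show "(1 / real (card I)) *\<^sub>R (\<Sum>i\<in>I. x i) \<in> C"
    unfolding e by (rule convex_sum[OF I(1) convex_on_imp_convex[OF f] s]) (use x in auto)
  have "f (\<Sum>i\<in>I. (1 / real (card I)) *\<^sub>R x i) \<le> (\<Sum>i\<in>I. 1 / real (card I) * f (x i))"
    by (rule convex_on_sum[OF I f s]) (use x in auto)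
  then show "f ((1 / real (card I)) *\<^sub>R (\<Sum>i\<in>I. x i)) \<le> (\<Sum>i\<in>I. f (x i)) / real (card I)"
    unfolding e by (simp add: sum_divide_distrib)
qed

text \<open>The subgradient form of strong convexity at the intermediate point z, weighted towards x and
y, cancels the linear terms.\<close>
lemma strongly_convex_interpolation:
  assumes n: "is_norm nE" and sc: "strongly_convex nE \<mu> S X f"
    and sub: "\<And>x. x \<in> X \<Longrightarrow> subdifferential S f x \<noteq> {}"
    and X: "convex X" "x \<in> X" "y \<in> X" and t: "0 \<le> t" "t \<le> 1"
  shows "f ((1 - t) *\<^sub>R y + t *\<^sub>R x) \<le> (1 - t) * f y + t * f x - \<mu> / 2 * (t * (1 - t) * (nE (x - y))\<^sup>2)"
proof -
  define z where "z = (1 - t) *\<^sub>R y + t *\<^sub>R x"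
  have z: "z \<in> X" unfolding z_def using X t unfolding convex_alt by auto
  then obtain p where p: "p \<in> subdifferential S f z" using sub by blast
  define K where "K = (nE (x - y))\<^sup>2"
  have e: "x - z = (1 - t) *\<^sub>R (x - y)" "y - z = (- t) *\<^sub>R (x - y)"
    unfolding z_def by (simp_all add: algebra_simps)
  have fxy: "f w \<ge> f z + p \<bullet> (w - z) + \<mu> / 2 * (nE (w - z))\<^sup>2" if "w \<in> X" for w
    using sc z that p unfolding strongly_convex_def by blast
  have fx: "f x \<ge> f z + (1 - t) * (p \<bullet> (x - y)) + \<mu> / 2 * ((1 - t)\<^sup>2 * K)"
    using fxy[OF X(2)] unfolding e is_norm_scaleR[OF n] K_def by (simp add: power_mult_distrib)
  have fy: "f y \<ge> f z - t * (p \<bullet> (x - y)) + \<mu> / 2 * (t\<^sup>2 * K)"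
    using fxy[OF X(3)] unfolding e is_norm_scaleR[OF n] K_def by (simp add: power_mult_distrib)
  have "t * (f z + (1 - t) * (p \<bullet> (x - y)) + \<mu> / 2 * ((1 - t)\<^sup>2 * K))
      + (1 - t) * (f z - t * (p \<bullet> (x - y)) + \<mu> / 2 * (t\<^sup>2 * K)) \<le> t * f x + (1 - t) * f y"
    using fx fy t by (intro add_mono mult_left_mono) auto
  moreover have "t * (f z + (1 - t) * (p \<bullet> (x - y)) + \<mu> / 2 * ((1 - t)\<^sup>2 * K))
      + (1 - t) * (f z - t * (p \<bullet> (x - y)) + \<mu> / 2 * (t\<^sup>2 * K)) = f z + \<mu> / 2 * (t * (1 - t) * K)"
    by (simp add: field_simps power2_eq_square)
  ultimately show ?thesis unfolding z_def[symmetric] K_def[symmetric] by linarith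
qed

text \<open>Instead of multipliers, the proof uses that max (f - f u) g is nonnegative on X: on the
segment from u to x either g is nonpositive, and then optimality of u bounds f from below, or g is positive. In both cases
strong convexity of the function concerned gives the same inequality.\<close>
lemma quadratic_growth_at_solution:
  assumes n: "is_norm nE" and X: "convex X"
    and f: "strongly_convex nE \<mu> X X f" "\<And>x. x \<in> X \<Longrightarrow> subdifferential X f x \<noteq> {}"
    and g: "strongly_convex nE \<mu> S X g" "\<And>x. x \<in> X \<Longrightarrow> subdifferential S g x \<noteq> {}"
    and sol: "is_arg_min f (\<lambda>x. x \<in> X \<and> g x \<le> 0) u"
    and x: "x \<in> X" "f x - f u \<le> \<delta>" "g x \<le> \<delta>" and \<mu>: "0 < \<mu>"
  shows "(nE (x - u))\<^sup>2 \<le> 2 * \<delta> / \<mu>"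
proof -
  have u: "u \<in> X" "g u \<le> 0" and opt: "\<And>z. z \<in> X \<Longrightarrow> g z \<le> 0 \<Longrightarrow> f u \<le> f z"
    using sol unfolding is_arg_min_def by (auto simp: not_less)
  define K where "K = (nE (x - u))\<^sup>2"
  have "0 \<le> \<delta> - \<mu> / 2 * K"
  proof (rule nonneg_if_quadratic_nonneg[where b = "\<mu> / 2 * K"])
    fix t :: real assume t: "0 < t" "t \<le> 1"
    define z where "z = (1 - t) *\<^sub>R u + t *\<^sub>R x"
    have z: "z \<in> X" unfolding z_def using X u x t unfolding convex_alt by auto
    have fz: "f z \<le> (1 - t) * f u + t * f x - \<mu> / 2 * (t * (1 - t) * K)"
      unfolding z_def K_def by (rule strongly_convex_interpolation[OF n f X x(1) u(1)]) (use t in auto)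
    have gz: "g z \<le> (1 - t) * g u + t * g x - \<mu> / 2 * (t * (1 - t) * K)"
      unfolding z_def K_def by (rule strongly_convex_interpolation[OF n g X x(1) u(1)]) (use t in auto)
    have "0 \<le> t * \<delta> - \<mu> / 2 * (t * (1 - t) * K)"
    proof (cases "g z \<le> 0")
      case True
      have "t * (f x - f u) \<le> t * \<delta>" using x(2) t by (intro mult_left_mono) auto
      moreover have "(1 - t) * f u + t * f x = f u + t * (f x - f u)" by (simp add: algebra_simps)
      ultimately show ?thesis using opt[OF z True] fz by linarith
    next
      case False
      have "t * g x \<le> t * \<delta>" using x(3) t by (intro mult_left_mono) auto
      moreover have "(1 - t) * g u \<le> 0" using u(2) t by (intro mult_nonneg_nonpos) auto
      ultimately show ?thesis using False gz by linarith
    qed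
    then show "0 \<le> t * (\<delta> - \<mu> / 2 * K) + t\<^sup>2 * (\<mu> / 2 * K)" by (simp add: algebra_simps power2_eq_square)
  qed
  then show ?thesis using \<mu> unfolding K_def[symmetric] by (simp add: field_simps)
qed

context prox_stage
begin

text \<open>The deterministic core. The vectors m k are the means of the stochastic subgradients
G k. The steps outside I each use up more than \<delta> of the total N * \<delta>, which leaves at most
card I * \<delta> for the steps in I; in particular I cannot be empty.\<close>
lemma stage_success:
  fixes x G m :: "nat \<Rightarrow> 'a" and f g :: "'a \<Rightarrow> real"
  assumes y: "y \<in> X" and u: "u \<in> Q y" and f: "convex_on X f" and g: "convex_on UNIV g"
    and gu: "g u \<le> 0" and \<delta>: "0 < \<delta>" and b: "0 < b" and \<Omega>: "0 \<le> \<Omega>" and N: "0 < N"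
    and start: "x 0 = y"
    and step: "\<And>k. x (Suc k) = mirr (Q y) (dr y) (gr y) (x k) ((\<delta> / (b\<^sup>2 * r\<^sup>2)) *\<^sub>R G k)"
    and G: "\<And>k v. k < N \<Longrightarrow> G k \<bullet> v \<le> b * nE v"
    and mf: "\<And>k. k < N \<Longrightarrow> g (x k) \<le> \<delta> \<Longrightarrow> f (x k) + m k \<bullet> (u - x k) \<le> f u"
    and mg: "\<And>k. k < N \<Longrightarrow> \<not> g (x k) \<le> \<delta> \<Longrightarrow> g (x k) + m k \<bullet> (u - x k) \<le> g u"
    and noise: "(\<Sum>k<N. (m k - G k) \<bullet> (x k - u)) \<le> real N * \<delta> / 2 - \<Omega> * b\<^sup>2 * r\<^sup>2 / (2 * \<delta>)"
  defines "I \<equiv> {k. k < N \<and> g (x k) \<le> \<delta>}"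
  defines "a \<equiv> (1 / real (card I)) *\<^sub>R (\<Sum>k\<in>I. x k)"
  shows "I \<noteq> {}" "a \<in> X" "f a - f u \<le> \<delta>" "g a \<le> \<delta>"
proof -
  have xX: "x k \<in> X" for k
  proof (cases k)
    case (Suc j) then show ?thesis unfolding Suc step mirr_eq_step using step_min(1)[OF y] by (auto simp: Q_iff)
  qed (use start y in simp)
  define h where "h = \<delta> / (b\<^sup>2 * r\<^sup>2)"
  have h: "0 < h" unfolding h_def using \<delta> b r_pos by simp
  define S where "S = (\<Sum>k<N. G k \<bullet> (x k - u))"
  have "h * S \<le> real N * (h\<^sup>2 * b\<^sup>2 * r\<^sup>2 / 2) + \<Omega> / 2 * (nE (u - y) / r)\<^sup>2"
    unfolding S_def by (rule mirror_descent_regret[where x = x and G = G, OF y u])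
      (use h step start G in \<open>auto simp: h_def\<close>)
  also have "(nE (u - y) / r)\<^sup>2 \<le> 1\<^sup>2"
    using u r_pos is_norm_nonneg[OF norm, of "u - y"] by (intro power_mono) (auto simp: Q_iff)
  then have "real N * (h\<^sup>2 * b\<^sup>2 * r\<^sup>2 / 2) + \<Omega> / 2 * (nE (u - y) / r)\<^sup>2
      \<le> real N * (h\<^sup>2 * b\<^sup>2 * r\<^sup>2 / 2) + \<Omega> / 2 * 1\<^sup>2"
    using \<Omega> by (intro add_left_mono mult_left_mono) auto
  also have "\<dots> = h * (real N * \<delta> / 2 + \<Omega> * b\<^sup>2 * r\<^sup>2 / (2 * \<delta>))"
    unfolding h_def using \<delta> b r_pos by (simp add: field_simps power2_eq_square)
  finally have "S \<le> real N * \<delta> / 2 + \<Omega> * b\<^sup>2 * r\<^sup>2 / (2 * \<delta>)" using h by simp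
  moreover have "(\<Sum>k<N. m k \<bullet> (x k - u)) = (\<Sum>k<N. (m k - G k) \<bullet> (x k - u)) + S"
    unfolding S_def sum.distrib[symmetric] by (simp add: inner_diff_left)
  ultimately have total: "(\<Sum>k<N. m k \<bullet> (x k - u)) \<le> real N * \<delta>" using noise by linarith
  have mf': "f (x k) - f u \<le> m k \<bullet> (x k - u)" if "k \<in> I" for k
    using mf[of k] that unfolding I_def by (simp add: inner_diff_right)
  have mg': "\<delta> < m k \<bullet> (x k - u)" if "k < N" "k \<notin> I" for k
    using mg[of k] that gu unfolding I_def by (simp add: inner_diff_right)
  have I: "I \<subseteq> {..<N}" "finite I" unfolding I_def by auto
  show ne: "I \<noteq> {}"
  proof
    assume "I = {}"
    then have "(\<Sum>k<N. \<delta>) < (\<Sum>k<N. m k \<bullet> (x k - u))" using mg' N by (intro sum_strict_mono) auto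
    then show False using total by simp
  qed
  have "(\<Sum>k\<in>I. f (x k) - f u) + (\<Sum>k\<in>{..<N} - I. \<delta>) \<le> (\<Sum>k\<in>I. m k \<bullet> (x k - u)) + (\<Sum>k\<in>{..<N} - I. m k \<bullet> (x k - u))"
    by (intro add_mono sum_mono) (use mf' mg' in force)+
  also have "\<dots> = (\<Sum>k<N. m k \<bullet> (x k - u))" using sum.subset_diff[OF I(1), of "\<lambda>k. m k \<bullet> (x k - u)"] by simp
  also note total
  also have "real N * \<delta> = (\<Sum>k\<in>{..<N} - I. \<delta>) + (\<Sum>k\<in>I. \<delta>)"
    using sum.subset_diff[OF I(1), of "\<lambda>k. \<delta>"] by simp
  finally have fI: "(\<Sum>k\<in>I. f (x k)) \<le> real (card I) * (f u + \<delta>)" by (simp add: sum_subtractf algebra_simps)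
  have card: "0 < real (card I)" using I ne by (simp add: card_gt_0_iff)
  show "a \<in> X" unfolding a_def by (rule convex_on_average(1)[OF f I(2) ne xX])
  have "f a \<le> (\<Sum>k\<in>I. f (x k)) / real (card I)" unfolding a_def by (rule convex_on_average(2)[OF f I(2) ne xX])
  also have "\<dots> \<le> f u + \<delta>" using fI card by (simp add: field_simps)
  finally show "f a - f u \<le> \<delta>" by simp
  have "g a \<le> (\<Sum>k\<in>I. g (x k)) / real (card I)" unfolding a_def by (rule convex_on_average(2)[OF g I(2) ne]) simp
  also have "(\<Sum>k\<in>I. g (x k)) \<le> (\<Sum>k\<in>I. \<delta>)" by (rule sum_mono) (auto simp: I_def)
  then have "(\<Sum>k\<in>I. g (x k)) / real (card I) \<le> \<delta>" using card by (simp add: field_simps)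
  finally show "g a \<le> \<delta>" .
qed

definition iter ::
  "('a \<Rightarrow> real) \<Rightarrow> ('a \<Rightarrow> 'b \<Rightarrow> 'a) \<Rightarrow> ('a \<Rightarrow> 'c \<Rightarrow> 'a) \<Rightarrow> real \<Rightarrow> real \<Rightarrow> 'a \<Rightarrow>
   (nat \<Rightarrow> 'b) \<Rightarrow> (nat \<Rightarrow> 'c) \<Rightarrow> nat \<Rightarrow> 'a" where
  "iter g Gf Gg \<delta> h y = smd_iter g Gf Gg \<delta> (Q y) (dr y) (gr y) h"

lemma iter_0: "y \<in> X \<Longrightarrow> iter g Gf Gg \<delta> h y \<xi> \<zeta> 0 = y"
  unfolding iter_def by (simp add: first_iterate)

lemma iter_Suc:
  "iter g Gf Gg \<delta> h y \<xi> \<zeta> (Suc k) = mirr (Q y) (dr y) (gr y) (iter g Gf Gg \<delta> h y \<xi> \<zeta> k)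
     (h *\<^sub>R (if g (iter g Gf Gg \<delta> h y \<xi> \<zeta> k) \<le> \<delta> then Gf (iter g Gf Gg \<delta> h y \<xi> \<zeta> k) (\<xi> k)
       else Gg (iter g Gf Gg \<delta> h y \<xi> \<zeta> k) (\<zeta> k)))"
  unfolding iter_def by (simp add: Let_def)

lemma iter_in_Q: "y \<in> X \<Longrightarrow> iter g Gf Gg \<delta> h y \<xi> \<zeta> k \<in> Q y"
  by (cases k) (simp_all add: iter_0 iter_Suc center_in_Q mirr_eq_step step_min)

lemma measurable_iter:
  fixes \<Xi> :: "'b measure" and Z :: "'c measure"
  assumes g: "g \<in> borel_measurable borel"
    and Gf: "(\<lambda>(x, w). Gf x w) \<in> borel_measurable (restrict_space borel X \<Otimes>\<^sub>M \<Xi>)"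
    and Gg: "(\<lambda>(x, w). Gg x w) \<in> borel_measurable (restrict_space borel X \<Otimes>\<^sub>M Z)"
    and y: "y \<in> measurable N (restrict_space borel X)"
    and \<xi>: "\<And>j. j < k \<Longrightarrow> \<xi> j \<in> measurable N \<Xi>" and \<zeta>: "\<And>j. j < k \<Longrightarrow> \<zeta> j \<in> measurable N Z"
  shows "(\<lambda>\<omega>. iter g Gf Gg \<delta> h (y \<omega>) (\<lambda>j. \<xi> j \<omega>) (\<lambda>j. \<zeta> j \<omega>) k) \<in> measurable N (restrict_space borel X)"
  using \<xi> \<zeta>
proof (induction k)
  have yX: "y \<omega> \<in> X" if "\<omega> \<in> space N" for \<omega> using measurable_space[OF y that] by (simp add: space_restrict_space)
  {
    case 0
    show ?case by (rule measurable_cong[THEN iffD2, OF _ y]) (simp add: iter_0 yX)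
  next
    case (Suc k)
    define x where "x \<omega> = iter g Gf Gg \<delta> h (y \<omega>) (\<lambda>j. \<xi> j \<omega>) (\<lambda>j. \<zeta> j \<omega>) k" for \<omega>
    have x: "x \<in> measurable N (restrict_space borel X)" unfolding x_def using Suc by simp
    have xb: "x \<in> borel_measurable N" and yb: "y \<in> borel_measurable N"
      using x y by (simp_all add: measurable_restrict_space2_iff)
    have inD: "(1 / r) *\<^sub>R (x \<omega> - y \<omega>) \<in> D" if "\<omega> \<in> space N" for \<omega>
      unfolding x_def by (rule scaled_in_D[OF yX[OF that] iter_in_Q[OF yX[OF that]]])
    have gx: "(\<lambda>\<omega>. g (x \<omega>)) \<in> borel_measurable N" by (rule measurable_compose[OF xb g])
    have Gfx: "(\<lambda>\<omega>. Gf (x \<omega>) (\<xi> k \<omega>)) \<in> borel_measurable N"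
      using measurable_compose[OF measurable_Pair[OF x Suc.prems(1)[of k]] Gf] by simp
    have Ggx: "(\<lambda>\<omega>. Gg (x \<omega>) (\<zeta> k \<omega>)) \<in> borel_measurable N"
      using measurable_compose[OF measurable_Pair[OF x Suc.prems(2)[of k]] Gg] by simp
    have "(\<lambda>\<omega>. (1 / r) *\<^sub>R (x \<omega> - y \<omega>)) \<in> measurable N (restrict_space borel D)"
      by (rule measurable_restrict_space2) (use inD xb yb in auto)
    then have grx: "(\<lambda>\<omega>. gr (y \<omega>) (x \<omega>)) \<in> borel_measurable N"
      unfolding gr_def
      by (intro borel_measurable_scaleR borel_measurable_const
          measurable_compose[OF _ borel_measurable_continuous_on_restrict[OF gd_cont]])
    define q where "q \<omega> = h *\<^sub>R (if g (x \<omega>) \<le> \<delta> then Gf (x \<omega>) (\<xi> k \<omega>) else Gg (x \<omega>) (\<zeta> k \<omega>)) - gr (y \<omega>) (x \<omega>)" for \<omega>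
    have "q \<in> borel_measurable N" unfolding q_def
      by (intro borel_measurable_diff borel_measurable_scaleR borel_measurable_const measurable_If
          Gfx Ggx grx) (use gx in measurable)
    then have "(\<lambda>\<omega>. (y \<omega>, q \<omega>)) \<in> measurable N (restrict_space borel (X \<times> UNIV))"
      using yb yX by (intro measurable_restrict_space2 borel_measurable_Pair) auto
    from measurable_compose[OF this borel_measurable_continuous_on_restrict[OF continuous_on_step]]
    have "(\<lambda>\<omega>. step (y \<omega>) (q \<omega>)) \<in> borel_measurable N" by simp
    moreover have "iter g Gf Gg \<delta> h (y \<omega>) (\<lambda>j. \<xi> j \<omega>) (\<lambda>j. \<zeta> j \<omega>) (Suc k) = step (y \<omega>) (q \<omega>)" for \<omega>
      unfolding iter_Suc mirr_eq_step q_def x_def ..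
    moreover have "step (y \<omega>) (q \<omega>) \<in> X" if "\<omega> \<in> space N" for \<omega>
      using step_min(1)[OF yX[OF that]] by (simp add: Q_iff)
    ultimately show ?case by (auto intro!: measurable_restrict_space2)
  }
qed

end

section \<open>Exponential moments of adapted noise\<close>

text \<open>The substitute for conditioning on the past: Y is the past, W the next noise variable, and
\<psi> (y, W) is integrated with y frozen. The bound is required only where the weight \<phi> is
nonzero, so that it may use properties of the past that hold on an event.\<close>
lemma (in prob_space) nn_integral_indep_step:
  fixes \<phi> :: "'b \<Rightarrow> ennreal" and \<psi> :: "'b \<times> 'b \<Rightarrow> ennreal"
  assumes ind: "indep_var S Y T W"
    and \<phi>: "\<phi> \<in> borel_measurable S" and \<psi>: "\<psi> \<in> borel_measurable (S \<Otimes>\<^sub>M T)"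
    and C: "\<And>y. y \<in> space S \<Longrightarrow> \<phi> y \<noteq> 0 \<Longrightarrow> (\<integral>\<^sup>+\<omega>. \<psi> (y, W \<omega>) \<partial>M) \<le> C"
  shows "(\<integral>\<^sup>+\<omega>. \<phi> (Y \<omega>) * \<psi> (Y \<omega>, W \<omega>) \<partial>M) \<le> C * (\<integral>\<^sup>+\<omega>. \<phi> (Y \<omega>) \<partial>M)"
proof -
  have Y: "random_variable S Y" and W: "random_variable T W"
    and dist: "distr M S Y \<Otimes>\<^sub>M distr M T W = distr M (S \<Otimes>\<^sub>M T) (\<lambda>\<omega>. (Y \<omega>, W \<omega>))"
    using ind unfolding indep_var_distribution_eq by auto
  interpret W: prob_space "distr M T W" by (rule prob_space_distr[OF W])
  have m: "(\<lambda>(y, t). \<phi> y * \<psi> (y, t)) \<in> borel_measurable (S \<Otimes>\<^sub>M T)"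
    using \<phi> \<psi> by measurable
  have "(\<integral>\<^sup>+\<omega>. \<phi> (Y \<omega>) * \<psi> (Y \<omega>, W \<omega>) \<partial>M)
      = (\<integral>\<^sup>+z. (\<lambda>(y, t). \<phi> y * \<psi> (y, t)) z \<partial>(distr M S Y \<Otimes>\<^sub>M distr M T W))"
    unfolding dist using m Y W by (subst nn_integral_distr) auto
  also have "\<dots> = (\<integral>\<^sup>+y. \<integral>\<^sup>+t. \<phi> y * \<psi> (y, t) \<partial>distr M T W \<partial>distr M S Y)"
    by (subst W.nn_integral_fst[symmetric]) (use m in \<open>auto cong: measurable_cong_sets\<close>)
  also have "\<dots> = (\<integral>\<^sup>+\<omega>. \<integral>\<^sup>+t. \<phi> (Y \<omega>) * \<psi> (Y \<omega>, t) \<partial>distr M T W \<partial>M)"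
  proof (rule nn_integral_distr[OF Y])
    have "(\<lambda>(y, t). \<phi> y * \<psi> (y, t)) \<in> borel_measurable (S \<Otimes>\<^sub>M distr M T W)"
      using m by (auto cong: measurable_cong_sets)
    from W.borel_measurable_nn_integral_fst[OF this]
    show "(\<lambda>y. \<integral>\<^sup>+t. \<phi> y * \<psi> (y, t) \<partial>distr M T W) \<in> borel_measurable (distr M S Y)" by simp
  qed
  also have "\<dots> \<le> (\<integral>\<^sup>+\<omega>. C * \<phi> (Y \<omega>) \<partial>M)"
  proof (rule nn_integral_mono)
    fix \<omega> assume \<omega>: "\<omega> \<in> space M"
    then have YS: "Y \<omega> \<in> space S" by (rule measurable_space[OF Y])
    have mt: "(\<lambda>t. \<psi> (Y \<omega>, t)) \<in> borel_measurable T"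
      using measurable_compose[OF measurable_Pair1'[OF YS] \<psi>] .
    have "(\<integral>\<^sup>+t. \<phi> (Y \<omega>) * \<psi> (Y \<omega>, t) \<partial>distr M T W) = \<phi> (Y \<omega>) * (\<integral>\<^sup>+\<omega>'. \<psi> (Y \<omega>, W \<omega>') \<partial>M)"
      using mt W by (simp add: nn_integral_distr nn_integral_cmult)
    also have "\<dots> \<le> \<phi> (Y \<omega>) * C"
      using C[OF YS] by (cases "\<phi> (Y \<omega>) = 0") (auto intro: mult_left_mono)
    finally show "(\<integral>\<^sup>+t. \<phi> (Y \<omega>) * \<psi> (Y \<omega>, t) \<partial>distr M T W) \<le> C * \<phi> (Y \<omega>)" by (simp add: mult.commute)
  qed
  also have "\<dots> = C * (\<integral>\<^sup>+\<omega>. \<phi> (Y \<omega>) \<partial>M)"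
    using Y \<phi> by (intro nn_integral_cmult) auto
  finally show ?thesis .
qed

text \<open>Hoeffding's lemma for an interval of half-length B whose midpoint c is arbitrary.\<close>
lemma (in prob_space) nn_integral_exp_le_Hoeffding:
  assumes U: "integrable M U" "expectation U = 0" and bd: "AE \<omega> in M. \<bar>U \<omega> - c\<bar> \<le> B" and s: "0 < s"
  shows "(\<integral>\<^sup>+\<omega>. ennreal (exp (s * U \<omega>)) \<partial>M) \<le> ennreal (exp (s\<^sup>2 * B\<^sup>2 / 2))"
proof -
  interpret interval_bounded_random_variable M U "c - B" "c + B"
    by unfold_locales (use U(1) bd in \<open>auto elim!: eventually_mono\<close>)
  have "(\<integral>\<^sup>+\<omega>. ennreal (exp (s * U \<omega>)) \<partial>M) \<le> ennreal (exp (s\<^sup>2 * (c + B - (c - B))\<^sup>2 / 8))"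
    by (rule Hoeffdings_lemma_nn_integral_0[OF s U(2)])
  also have "(c + B - (c - B))\<^sup>2 = 4 * B\<^sup>2" by (simp add: power2_eq_square algebra_simps)
  finally show ?thesis by (simp add: mult.commute)
qed

text \<open>Here t is the noise threshold of a stage with N steps, and t / (4 * N * b^2 * r^2) is the
parameter that minimizes the Chernoff bound. The constant 70 leaves enough room for t to lose the
second summand and for the exponent still to reach 2 * l.\<close>
lemma chernoff_exponent:
  fixes N \<delta> b r \<Omega> l :: real
  assumes pos: "0 < \<delta>" "0 < b" "0 < r" "0 < \<Omega>" and l: "1 / 2 \<le> l"
    and N: "70 * (b\<^sup>2 * \<Omega> * r\<^sup>2 / \<delta>\<^sup>2) * l \<le> N"
  defines "t \<equiv> N * \<delta> / 2 - \<Omega> * b\<^sup>2 * r\<^sup>2 / (2 * \<delta>)"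
  shows "0 < t"
    "1 \<le> \<Omega> \<Longrightarrow> N * ((t / (4 * N * b\<^sup>2 * r\<^sup>2))\<^sup>2 * (2 * b * r)\<^sup>2 / 2) - t / (4 * N * b\<^sup>2 * r\<^sup>2) * t \<le> - (2 * l)"
proof -
  define a where "a = b\<^sup>2 * r\<^sup>2 / \<delta>\<^sup>2"
  have a: "0 < a" using pos by (simp add: a_def)
  have Na: "70 * a * \<Omega> * l \<le> N" using N by (simp add: a_def mult.commute mult.left_commute)
  have "a * \<Omega> * (1 / 2) \<le> a * \<Omega> * l" using a pos l by (intro mult_left_mono) auto
  then have Na2: "35 * (a * \<Omega>) \<le> N" using Na by (simp add: mult.assoc)
  have Npos: "0 < N" using Na2 a pos by (smt (verit) mult_pos_pos)
  have t: "t = \<delta> * (N / 2 - \<Omega> * a / 2)" unfolding t_def a_def using pos by (simp add: field_simps power2_eq_square)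
  \<comment> \<open>1/2 - 1/70 = 17/35\<close>
  have "17 / 35 * N \<le> N / 2 - \<Omega> * a / 2" using Na2 by (simp add: field_simps)
  then have tb: "\<delta> * (17 / 35 * N) \<le> t" unfolding t using pos by (intro mult_left_mono) auto
  then show tpos: "0 < t" using pos Npos by (smt (verit) mult_pos_pos divide_pos_pos)
  assume \<Omega>: "1 \<le> \<Omega>"
  have "(\<delta> * (17 / 35 * N))\<^sup>2 \<le> t\<^sup>2" using tb pos Npos by (intro power_mono) auto
  then have "(\<delta> * (17 / 35 * N))\<^sup>2 / (8 * N * (b\<^sup>2 * r\<^sup>2)) \<le> t\<^sup>2 / (8 * N * (b\<^sup>2 * r\<^sup>2))"
    using pos Npos by (intro divide_right_mono) auto
  also have "(\<delta> * (17 / 35 * N))\<^sup>2 / (8 * N * (b\<^sup>2 * r\<^sup>2)) = 289 / 9800 * (N / a)"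
    unfolding a_def using pos Npos by (simp add: field_simps power2_eq_square)
  finally have 1: "289 / 9800 * (N / a) \<le> t\<^sup>2 / (8 * N * (b\<^sup>2 * r\<^sup>2))" .
  have "70 * l \<le> 70 * \<Omega> * l" using \<Omega> l by (simp add: mult_right_mono)
  also have "\<dots> \<le> N / a" using Na a by (simp add: field_simps)
  \<comment> \<open>289/9800 * 70 is larger than 2\<close>
  finally have "2 * l \<le> t\<^sup>2 / (8 * N * (b\<^sup>2 * r\<^sup>2))" using 1 l by linarith
  moreover have "N * ((t / (4 * N * b\<^sup>2 * r\<^sup>2))\<^sup>2 * (2 * b * r)\<^sup>2 / 2) - t / (4 * N * b\<^sup>2 * r\<^sup>2) * t
      = - (t\<^sup>2 / (8 * N * (b\<^sup>2 * r\<^sup>2)))"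
    using pos Npos by (simp add: field_simps power2_eq_square)
  ultimately show "N * ((t / (4 * N * b\<^sup>2 * r\<^sup>2))\<^sup>2 * (2 * b * r)\<^sup>2 / 2) - t / (4 * N * b\<^sup>2 * r\<^sup>2) * t \<le> - (2 * l)"
    by linarith
qed

lemma continuous_on_if_norm_lipschitz:
  fixes f :: "'a::euclidean_space \<Rightarrow> real"
  assumes n: "is_norm nE" and lip: "\<And>x y. x \<in> X \<Longrightarrow> y \<in> X \<Longrightarrow> \<bar>f x - f y\<bar> \<le> C * nE (x - y)"
  shows "continuous_on X f"
  unfolding continuous_on_def
proof
  fix x assume x: "x \<in> X"
  have c: "continuous_on UNIV (\<lambda>z. C * nE (z - x))"
    by (intro continuous_intros continuous_on_compose2[OF is_norm_continuous[OF n, of UNIV]]) auto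
  have lim: "((\<lambda>z. C * nE (z - x)) \<longlongrightarrow> C * nE (x - x)) (at x within X)"
    using continuous_on_subset[OF c subset_UNIV, of X] x unfolding continuous_on_def by blast
  have "((\<lambda>z. dist (f z) (f x)) \<longlongrightarrow> 0) (at x within X)"
  proof (rule tendsto_sandwich[of "\<lambda>_. 0" _ _ "\<lambda>z. C * nE (z - x)"])
    show "((\<lambda>z. C * nE (z - x)) \<longlongrightarrow> 0) (at x within X)" using lim n by simp
    show "\<forall>\<^sub>F z in at x within X. dist (f z) (f x) \<le> C * nE (z - x)"
      unfolding eventually_at_filter dist_real_def by (intro always_eventually) (use lip x in auto)
  qed auto
  then show "(f \<longlongrightarrow> f x) (at x within X)" using tendsto_dist_iff by blast
qed

section \<open>Schedule of the restarts\<close>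

lemma radius_pos: "0 < R0 \<Longrightarrow> 0 < radius R0 p"
  by (simp add: radius_def)

lemma radius_squared: "(radius R0 p)\<^sup>2 = R0\<^sup>2 / 2 ^ p"
  by (simp add: radius_def)

lemma stage_acc_eq: "stage_acc \<mu> R0 p = \<mu> * R0\<^sup>2 / (2 * 2 ^ p)"
  by (simp add: stage_acc_def radius_squared)

lemma num_stages_eq_ceiling:
  assumes "0 < log_stages \<mu> R0 \<epsilon>"
  shows "num_stages \<mu> R0 \<epsilon> = nat \<lceil>log_stages \<mu> R0 \<epsilon>\<rceil>"
  unfolding num_stages_def
proof (rule Least_equality)
  show "1 \<le> nat \<lceil>log_stages \<mu> R0 \<epsilon>\<rceil> \<and> log_stages \<mu> R0 \<epsilon> \<le> real (nat \<lceil>log_stages \<mu> R0 \<epsilon>\<rceil>)"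
    using assms by (simp add: real_nat_ceiling_ge Suc_le_eq)
  fix p assume "1 \<le> p \<and> log_stages \<mu> R0 \<epsilon> \<le> real p"
  then show "nat \<lceil>log_stages \<mu> R0 \<epsilon>\<rceil> \<le> p" by (simp add: nat_le_iff ceiling_le_iff)
qed

lemma two_powr_log_stages:
  assumes "0 < \<mu>" "0 < R0" "0 < \<epsilon>"
  shows "2 powr log_stages \<mu> R0 \<epsilon> = \<mu> * R0\<^sup>2 / (2 * \<epsilon>)"
  unfolding log_stages_def using assms by (intro powr_log_cancel) auto

lemma final_stage_acc_le:
  assumes pos: "0 < \<mu>" "0 < R0" "0 < \<epsilon>" and L: "0 < log_stages \<mu> R0 \<epsilon>"
  shows "stage_acc \<mu> R0 (num_stages \<mu> R0 \<epsilon>) \<le> \<epsilon>"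
proof -
  let ?P = "num_stages \<mu> R0 \<epsilon>"
  have "log_stages \<mu> R0 \<epsilon> \<le> real ?P" unfolding num_stages_eq_ceiling[OF L] by (rule real_nat_ceiling_ge)
  then have "2 powr log_stages \<mu> R0 \<epsilon> \<le> 2 powr real ?P" by simp
  then have "\<mu> * R0\<^sup>2 / (2 * \<epsilon>) \<le> 2 ^ ?P" unfolding two_powr_log_stages[OF pos] by (simp add: powr_realpow)
  then show ?thesis unfolding stage_acc_eq using pos by (simp add: field_simps)
qed

text \<open>The numbers of iterations grow geometrically, since the squared radii are halved, so the
last stage dominates. Rounding up costs one iteration per stage.\<close>
lemma total_iterations_le:
  fixes Mf Mg \<Omega> \<mu> R0 \<epsilon> \<sigma> :: real
  assumes pos: "0 < \<mu>" "0 < R0" "0 < \<epsilon>" "0 < \<sigma>" "0 < \<Omega>" and L: "0 < log_stages \<mu> R0 \<epsilon>"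
    and l: "0 \<le> ln (1 / \<sigma> * log_stages \<mu> R0 \<epsilon>)"
  shows "real (\<Sum>p = 1..num_stages \<mu> R0 \<epsilon>. stage_iters Mf Mg \<Omega> \<mu> R0 \<epsilon> \<sigma> p)
    \<le> real_of_int \<lceil>log_stages \<mu> R0 \<epsilon>\<rceil>
      + 2240 * \<Omega> * max (Mf\<^sup>2) (Mg\<^sup>2) / (\<mu> * \<epsilon>) * (ln (1 / \<sigma>) + ln (log_stages \<mu> R0 \<epsilon>))"
proof -
  define L P B l where "L = log_stages \<mu> R0 \<epsilon>" and "P = num_stages \<mu> R0 \<epsilon>"
    and "B = max (Mf\<^sup>2) (Mg\<^sup>2)" and "l = ln (1 / \<sigma> * L)"
  have B: "0 \<le> B" unfolding B_def by (simp add: le_max_iff_disj)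
  have l0: "0 \<le> l" using l unfolding l_def L_def .
  \<comment> \<open>560 = 70 * 8, and squared radius over squared accuracy is 8 * 2^p / (\<mu>^2 * R0^2)\<close>
  define c where "c = 560 * B * \<Omega> * l / (\<mu>\<^sup>2 * R0\<^sup>2)"
  have c: "0 \<le> c" unfolding c_def using B l0 pos by simp
  have it: "real (stage_iters Mf Mg \<Omega> \<mu> R0 \<epsilon> \<sigma> p) \<le> 1 + c * 2 ^ p" if "p \<in> {1..P}" for p
  proof -
    obtain q where q: "p = Suc q" using \<open>p \<in> {1..P}\<close> by (cases p) auto
    have "70 * (B * \<Omega> * (radius R0 (p - 1))\<^sup>2 / (stage_acc \<mu> R0 p)\<^sup>2) * l = c * 2 ^ p"
      unfolding q radius_squared stage_acc_eq c_def using pos by (simp add: field_simps power2_eq_square)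
    then have "stage_iters Mf Mg \<Omega> \<mu> R0 \<epsilon> \<sigma> p = nat \<lceil>c * 2 ^ p\<rceil>"
      unfolding stage_iters_def B_def l_def L_def by simp
    moreover have "0 \<le> c * 2 ^ p" using c by simp
    ultimately show ?thesis by (simp, linarith)
  qed
  have "real (\<Sum>p = 1..P. stage_iters Mf Mg \<Omega> \<mu> R0 \<epsilon> \<sigma> p) \<le> (\<Sum>p = 1..P. 1 + c * 2 ^ p)"
    unfolding of_nat_sum by (rule sum_mono) (rule it)
  also have "\<dots> = real P + c * (\<Sum>p = 1..P. 2 ^ p)" by (simp add: sum.distrib sum_distrib_left)
  also have "(\<Sum>p = 1..P. (2::real) ^ p) \<le> 2 * 2 ^ P"
  proof (induction P)
    case (Suc P)
    have "(\<Sum>p = 1..Suc P. (2::real) ^ p) = (\<Sum>p = 1..P. 2 ^ p) + 2 ^ Suc P" by simp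
    then show ?case using Suc by simp
  qed simp
  also have "2 * 2 ^ P \<le> 2 * (2 * (\<mu> * R0\<^sup>2 / (2 * \<epsilon>)))"
  proof -
    have "real P \<le> L + 1" unfolding P_def num_stages_eq_ceiling[OF L] L_def using L by linarith
    then have "2 powr real P \<le> 2 powr (L + 1)" by simp
    then show ?thesis unfolding powr_add L_def two_powr_log_stages[OF pos(1-3)] by (simp add: powr_realpow)
  qed
  finally have "real (\<Sum>p = 1..P. stage_iters Mf Mg \<Omega> \<mu> R0 \<epsilon> \<sigma> p) \<le> real P + c * (2 * \<mu> * R0\<^sup>2 / \<epsilon>)"
    using c by (simp add: mult_left_mono)
  also have "c * (2 * \<mu> * R0\<^sup>2 / \<epsilon>) = 1120 * \<Omega> * B / (\<mu> * \<epsilon>) * l"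
    unfolding c_def using pos by (simp add: field_simps power2_eq_square)
  also have "\<dots> \<le> 2240 * \<Omega> * B / (\<mu> * \<epsilon>) * l"
    using l0 B pos by (intro mult_right_mono divide_right_mono) auto
  also have "l = ln (1 / \<sigma>) + ln L" unfolding l_def using pos L L_def by (intro ln_mult_pos) auto
  also have "real P = real_of_int \<lceil>L\<rceil>"
    unfolding P_def num_stages_eq_ceiling[OF L] L_def using L by simp
  finally show ?thesis unfolding P_def B_def L_def by simp
qed

text \<open>Each stage may fail with probability (\<sigma> / L)^2. For L at least 1 there are at most
2 * L stages and the first part of the hypothesis suffices; for L below 1 there is one stage
and the second part is the needed bound.\<close>
lemma restart_failure_budget:
  fixes L \<sigma> :: real
  assumes \<sigma>: "0 < \<sigma>" and log_factor: "2 * \<sigma> \<le> min L (L\<^sup>2)"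
  shows "0 < L" "1 / 2 \<le> ln (1 / \<sigma> * L)" "real (nat \<lceil>L\<rceil>) * exp (- (2 * ln (1 / \<sigma> * L))) \<le> \<sigma>"
proof -
  have LL: "2 * \<sigma> \<le> L" "2 * \<sigma> \<le> L\<^sup>2" using log_factor by auto
  show L: "0 < L" using LL \<sigma> by linarith
  have "2 \<le> 1 / \<sigma> * L" using LL \<sigma> by (simp add: field_simps)
  then have "ln 2 \<le> ln (1 / \<sigma> * L)" using \<sigma> L by simp
  then show "1 / 2 \<le> ln (1 / \<sigma> * L)" using ln2_ge_two_thirds by linarith
  have "exp (- (2 * ln (1 / \<sigma> * L))) = (\<sigma> / L)\<^sup>2"
  proof -
    have "2 * ln (1 / \<sigma> * L) = ln ((1 / \<sigma> * L)\<^sup>2)" using \<sigma> L by (simp add: ln_realpow)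
    then have "exp (- (2 * ln (1 / \<sigma> * L))) = inverse ((1 / \<sigma> * L)\<^sup>2)"
      using \<sigma> L by (simp add: exp_minus)
    then show ?thesis using \<sigma> L by (simp add: field_simps)
  qed
  moreover have "real (nat \<lceil>L\<rceil>) * (\<sigma> / L)\<^sup>2 \<le> \<sigma>"
  proof (cases "L < 1")
    case True
    then have "\<lceil>L\<rceil> = 1" using L by linarith
    moreover have "\<sigma> * \<sigma> \<le> \<sigma> * L\<^sup>2" using LL(2) \<sigma> by (intro mult_left_mono) auto
    ultimately show ?thesis using L by (simp add: field_simps power2_eq_square)
  next
    case False
    have "real (nat \<lceil>L\<rceil>) \<le> 2 * L" using False by linarith
    then have "real (nat \<lceil>L\<rceil>) * (\<sigma> / L)\<^sup>2 \<le> 2 * L * (\<sigma> / L)\<^sup>2" by (rule mult_right_mono) simp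
    also have "\<dots> = \<sigma> * (2 * \<sigma> / L)" using L by (simp add: field_simps power2_eq_square)
    also have "\<dots> \<le> \<sigma> * 1" using LL \<sigma> L by (intro mult_left_mono) (auto simp: field_simps)
    finally show ?thesis by simp
  qed
  ultimately show "real (nat \<lceil>L\<rceil>) * exp (- (2 * ln (1 / \<sigma> * L))) \<le> \<sigma>" by simp
qed

section \<open>The random run of the restarted method\<close>

lemma smd_iter_cong:
  assumes "\<And>j. j < k \<Longrightarrow> \<xi> j = \<xi>' j" "\<And>j. j < k \<Longrightarrow> \<zeta> j = \<zeta>' j"
  shows "smd_iter g Gf Gg \<delta> Q d gd h \<xi> \<zeta> k = smd_iter g Gf Gg \<delta> Q d gd h \<xi>' \<zeta>' k"
  using assms by (induction k) (simp_all add: Let_def)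

lemma restarted_smd_cong:
  assumes "\<And>q. 1 \<le> q \<Longrightarrow> q \<le> p \<Longrightarrow> \<xi> q = \<xi>' q" "\<And>q. 1 \<le> q \<Longrightarrow> q \<le> p \<Longrightarrow> \<zeta> q = \<zeta>' q"
  shows "restarted_smd nE X g Gf Gg d gd Mf Mg \<Omega> \<mu> R0 \<epsilon> \<sigma> x0 \<xi> \<zeta> p
    = restarted_smd nE X g Gf Gg d gd Mf Mg \<Omega> \<mu> R0 \<epsilon> \<sigma> x0 \<xi>' \<zeta>' p"
  using assms
proof (induction p)
  case (Suc p)
  have "\<xi> (Suc p) = \<xi>' (Suc p)" "\<zeta> (Suc p) = \<zeta>' (Suc p)" using Suc.prems by auto
  moreover have "restarted_smd nE X g Gf Gg d gd Mf Mg \<Omega> \<mu> R0 \<epsilon> \<sigma> x0 \<xi> \<zeta> p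
    = restarted_smd nE X g Gf Gg d gd Mf Mg \<Omega> \<mu> R0 \<epsilon> \<sigma> x0 \<xi>' \<zeta>' p" using Suc by auto
  ultimately show ?case by (simp split: option.split)
qed simp

text \<open>The setting of the convergence theorem, with the prox-function already known to be smooth on
its domain and the Lipschitz bound on f turned into continuity.\<close>
locale restarted_smd_problem =
  fixes nE :: "'a::euclidean_space \<Rightarrow> real"
    and X D :: "'a set"
    and f g d :: "'a \<Rightarrow> real"
    and gd :: "'a \<Rightarrow> 'a"
    and Gf :: "'a \<Rightarrow> 'b \<Rightarrow> 'a"
    and Gg :: "'a \<Rightarrow> 'c \<Rightarrow> 'a"
    and \<Xi> :: "'b measure"
    and Z :: "'c measure"
    and M :: "'w measure"
    and \<xi> :: "nat \<Rightarrow> nat \<Rightarrow> 'w \<Rightarrow> 'b"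
    and \<zeta> :: "nat \<Rightarrow> nat \<Rightarrow> 'w \<Rightarrow> 'c"
    and Mf Mg \<Omega> \<mu> R0 \<epsilon> \<sigma> :: real
    and x0 xs :: 'a
  assumes prox: "smooth_prox nE D d gd \<Omega>"
    and X: "closed X" "convex X"
    and f: "convex_on X f"
    and g: "convex_on UNIV g"
    and solution: "is_arg_min f (\<lambda>x. x \<in> X \<and> g x \<le> 0) xs"
    and f_cont: "continuous_on X f"
    and M_pos: "0 < max (Mf\<^sup>2) (Mg\<^sup>2)"
    and prob_M: "prob_space M"
    and prob_spaces: "prob_space \<Xi>" "prob_space Z"
    and Gf_measurable:
      "(\<lambda>(x, w). Gf x w) \<in> borel_measurable (restrict_space borel X \<Otimes>\<^sub>M \<Xi>)"
    and Gg_measurable: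
      "(\<lambda>(x, w). Gg x w) \<in> borel_measurable (restrict_space borel X \<Otimes>\<^sub>M Z)"
    and Gf_mean: "\<And>x. x \<in> X \<Longrightarrow> integrable \<Xi> (Gf x)"
      "\<And>x. x \<in> X \<Longrightarrow> (\<integral>w. Gf x w \<partial>\<Xi>) \<in> subdifferential X f x"
    and Gg_mean: "\<And>x. x \<in> X \<Longrightarrow> integrable Z (Gg x)"
      "\<And>x. x \<in> X \<Longrightarrow> (\<integral>w. Gg x w \<partial>Z) \<in> subdifferential UNIV g x"
    and Gf_bound: "\<And>x. x \<in> X \<Longrightarrow> AE w in \<Xi>. dual_norm nE (Gf x w) \<le> Mf"
    and Gg_bound: "\<And>x. x \<in> X \<Longrightarrow> AE w in Z. dual_norm nE (Gg x w) \<le> Mg"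
    and \<mu>: "0 < \<mu>"
    and f_strong: "strongly_convex nE \<mu> X X f"
    and g_strong: "strongly_convex nE \<mu> UNIV X g"
    and D_superset: "X \<subseteq> D"
    and D_rescaled: "\<And>p x y. p < num_stages \<mu> R0 \<epsilon> \<Longrightarrow> x \<in> X \<Longrightarrow> y \<in> X \<Longrightarrow>
      nE (x - y) \<le> radius R0 p \<Longrightarrow> (1 / radius R0 p) *\<^sub>R (x - y) \<in> D"
    and \<Omega>_pos: "0 < \<Omega>"
    and x0: "x0 \<in> X"
    and R0: "0 < R0" "(nE (x0 - xs))\<^sup>2 \<le> R0\<^sup>2"
    and \<xi>_distr: "\<And>p k. 1 \<le> p \<Longrightarrow> distr M \<Xi> (\<xi> p k) = \<Xi>"
    and \<zeta>_distr: "\<And>p k. 1 \<le> p \<Longrightarrow> distr M Z (\<zeta> p k) = Z"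
    and indep: "prob_space.indep_vars M (\<lambda>_. \<Xi> \<Otimes>\<^sub>M Z)
      (\<lambda>(p, k) \<omega>. (\<xi> p k \<omega>, \<zeta> p k \<omega>)) ({1..} \<times> UNIV)"
    and \<epsilon>: "0 < \<epsilon>"
    and \<sigma>: "0 < \<sigma>"
    and log_factor: "2 * \<sigma> \<le> min (log_stages \<mu> R0 \<epsilon>) ((log_stages \<mu> R0 \<epsilon>)\<^sup>2)"
begin

sublocale prob_space M by (rule prob_M)
sublocale \<Xi>: prob_space \<Xi> by (rule prob_spaces)
sublocale Z: prob_space Z by (rule prob_spaces)
sublocale prox: smooth_prox nE D d gd \<Omega> by (rule prox)

abbreviation T where "T \<equiv> \<Xi> \<Otimes>\<^sub>M Z"
abbreviation XB where "XB \<equiv> restrict_space borel X"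
definition P where "P = num_stages \<mu> R0 \<epsilon>"
definition logfac where "logfac = ln (1 / \<sigma> * log_stages \<mu> R0 \<epsilon>)"
definition Mmax where "Mmax = sqrt (max (Mf\<^sup>2) (Mg\<^sup>2))"
text \<open>Stages are counted from 0 below: index p stands for the stage that leads from the center
number p to the center number p + 1.\<close>
definition rad where "rad p = radius R0 p"
definition acc where "acc p = stage_acc \<mu> R0 (Suc p)"
definition iters where "iters p = stage_iters Mf Mg \<Omega> \<mu> R0 \<epsilon> \<sigma> (Suc p)"
definition stepsize where "stepsize p = acc p / (Mmax\<^sup>2 * (rad p)\<^sup>2)"

text \<open>The run as a deterministic function of the array w of all noise variables, indexed by
stage and iteration. This separates measurability and adaptedness, which concern w, from the
distribution of the noise.\<close>
definition out where
  "out w p = restarted_smd nE X g Gf Gg d gd Mf Mg \<Omega> \<mu> R0 \<epsilon> \<sigma> x0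
     (\<lambda>p k. fst (w (p, k))) (\<lambda>p k. snd (w (p, k))) p"
text \<open>The default x0 keeps the center a point of X after a stage without output, so that the
iterates make sense for every w.\<close>
definition center where "center w p = (case out w p of None \<Rightarrow> x0 | Some y \<Rightarrow> y)"
definition point where
  "point p w k = prox_stage.iter nE d gd X (rad p) g Gf Gg (acc p) (stepsize p) (center w p)
     (\<lambda>j. fst (w (Suc p, j))) (\<lambda>j. snd (w (Suc p, j))) k"
definition good where "good p w k \<longleftrightarrow> g (point p w k) \<le> acc p"

lemma Mmax_facts: "0 < Mmax" "Mmax\<^sup>2 = max (Mf\<^sup>2) (Mg\<^sup>2)" "Mf \<le> Mmax" "Mg \<le> Mmax"
proof -
  show "0 < Mmax" "Mmax\<^sup>2 = max (Mf\<^sup>2) (Mg\<^sup>2)" unfolding Mmax_def using M_pos by auto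
  show "Mf \<le> Mmax" "Mg \<le> Mmax" unfolding Mmax_def by (rule real_le_rsqrt, simp)+
qed

lemma rad_pos: "0 < rad p" unfolding rad_def by (rule radius_pos[OF R0(1)])

lemma acc_pos: "0 < acc p" unfolding acc_def stage_acc_eq using \<mu> R0 by simp

lemma rad_Suc: "(rad (Suc p))\<^sup>2 = 2 * acc p / \<mu>"
  unfolding rad_def acc_def stage_acc_def using \<mu> by simp

lemma L_pos: "0 < log_stages \<mu> R0 \<epsilon>" and logfac_ge: "1 / 2 \<le> logfac"
  and failure_budget: "real P * exp (- (2 * logfac)) \<le> \<sigma>"
  using restart_failure_budget[OF \<sigma> log_factor] num_stages_eq_ceiling
  unfolding logfac_def P_def by auto

lemma iters_ge: "70 * (Mmax\<^sup>2 * \<Omega> * (rad p)\<^sup>2 / (acc p)\<^sup>2) * logfac \<le> real (iters p)"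
  unfolding iters_def stage_iters_def Mmax_facts(2) rad_def acc_def logfac_def
  by (simp only: diff_Suc_1 real_nat_ceiling_ge)

lemma iters_pos: "0 < iters p"
proof -
  have "0 < 70 * (Mmax\<^sup>2 * \<Omega> * (rad p)\<^sup>2 / (acc p)\<^sup>2) * logfac"
    using Mmax_facts(1) \<Omega>_pos rad_pos[of p] acc_pos[of p] logfac_ge by simp
  then show ?thesis using iters_ge[of p] by (metis of_nat_0_less_iff order_less_le_trans)
qed

lemma xs: "xs \<in> X" "g xs \<le> 0"
  using solution unfolding is_arg_min_def by auto

lemma g_cont: "continuous_on UNIV g" by (rule convex_on_continuous[OF open_UNIV g])

lemma g_meas: "g \<in> borel_measurable borel" by (rule borel_measurable_continuous_onI[OF g_cont])

lemma stage: "p < P \<Longrightarrow> prox_stage nE D d gd \<Omega> X (rad p)"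
  by unfold_locales (use X rad_pos D_rescaled[of p] in \<open>auto simp: P_def rad_def\<close>)

lemma out_Suc:
  assumes p: "p < P"
  shows "out w (Suc p) = (if out w p = None \<or> (\<forall>k<iters p. \<not> good p w k) then None
    else Some ((1 / real (card {k. k < iters p \<and> good p w k})) *\<^sub>R (\<Sum>k\<in>{k. k < iters p \<and> good p w k}. point p w k)))"
proof -
  interpret S: prox_stage nE D d gd \<Omega> X "rad p" by (rule stage[OF p])
  show ?thesis
  proof (cases "out w p")
    case None
    then show ?thesis by (simp add: out_def)
  next
    case (Some y)
    have q: "S.Q y = {x \<in> X. (nE (x - y))\<^sup>2 \<le> (rad p)\<^sup>2}"
      "S.dr y = (\<lambda>x. d ((1 / rad p) *\<^sub>R (x - y)))"
      "S.gr y = (\<lambda>x. (1 / rad p) *\<^sub>R gd ((1 / rad p) *\<^sub>R (x - y)))"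
      by (simp_all add: S.Q_def S.dr_def S.gr_def fun_eq_iff)
    have c: "center w p = y" unfolding center_def Some by simp
    have "out w (Suc p) = smd g Gf Gg (acc p) (iters p) (S.Q y) (S.dr y) (S.gr y) (stepsize p)
        (\<lambda>j. fst (w (Suc p, j))) (\<lambda>j. snd (w (Suc p, j)))"
      using Some unfolding q unfolding out_def acc_def iters_def rad_def stepsize_def Mmax_facts(2)
      by (simp add: Let_def)
    then show ?thesis
      unfolding smd_def Let_def good_def point_def S.iter_def c using Some by auto
  qed
qed

lemma point_in_Q: "p < P \<Longrightarrow> center w p \<in> X \<Longrightarrow> point p w k \<in> prox_stage.Q nE X (rad p) (center w p)"
  unfolding point_def by (rule prox_stage.iter_in_Q[OF stage])

lemma point_in_X: "p < P \<Longrightarrow> center w p \<in> X \<Longrightarrow> point p w k \<in> X"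
  using point_in_Q prox_stage.Q_iff[OF stage] by blast

text \<open>A form without the random index set, suited to measurability.\<close>
lemma center_Suc:
  assumes p: "p < P"
  shows "center w (Suc p) = (if out w p = None \<or> (\<forall>k<iters p. \<not> good p w k) then x0
    else (1 / (\<Sum>k<iters p. if good p w k then 1 else 0)) *\<^sub>R (\<Sum>k<iters p. if good p w k then point p w k else 0))"
proof -
  have "{k. k < iters p \<and> good p w k} = {k \<in> {..<iters p}. good p w k}" by auto
  then show ?thesis unfolding center_def out_Suc[OF p] by (auto simp: sum.If_cases Int_def)
qed

lemma center_in_X: "p \<le> P \<Longrightarrow> center w p \<in> X"
proof (induction p)
  case 0
  then show ?case using x0 by (simp add: center_def out_def)
next
  case (Suc p)
  then have p: "p < P" and c: "center w p \<in> X" by auto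
  have "(1 / real (card {k. k < iters p \<and> good p w k})) *\<^sub>R (\<Sum>k\<in>{k. k < iters p \<and> good p w k}. point p w k) \<in> X"
    if "\<not> (\<forall>k<iters p. \<not> good p w k)"
    by (rule convex_on_average(1)[OF f]) (use that point_in_X[OF p c] in auto)
  then show ?case unfolding center_def out_Suc[OF p] using x0 by (auto split: if_splits)
qed

section \<open>Adaptedness\<close>

text \<open>The noise variables drawn before iteration k of the stage with index p. Stage numbers start at 1.\<close>
definition past :: "nat \<Rightarrow> nat \<Rightarrow> (nat \<times> nat) set" where
  "past p k = {(q, j). 1 \<le> q \<and> (q \<le> p \<or> q = Suc p \<and> j < k)}"

lemma out_cong: "(\<And>i. i \<in> past p 0 \<Longrightarrow> w i = w' i) \<Longrightarrow> out w p = out w' p"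
  unfolding out_def by (rule restarted_smd_cong) (auto simp: past_def)

lemma center_cong: "(\<And>i. i \<in> past p 0 \<Longrightarrow> w i = w' i) \<Longrightarrow> center w p = center w' p"
  unfolding center_def using out_cong[of p w w'] by auto

lemma point_cong:
  assumes p: "p < P" and eq: "\<And>i. i \<in> past p k \<Longrightarrow> w i = w' i"
  shows "point p w k = point p w' k"
proof -
  interpret S: prox_stage nE D d gd \<Omega> X "rad p" by (rule stage[OF p])
  have "center w p = center w' p" by (rule center_cong) (rule eq, auto simp: past_def)
  then show ?thesis unfolding point_def S.iter_def
    by (simp, intro smd_iter_cong) (auto simp: eq past_def)
qed

lemma measurable_point_if_center:
  assumes p: "p < P" and c: "(\<lambda>w. center w p) \<in> measurable (PiM B (\<lambda>_. T)) XB" and B: "past p k \<subseteq> B"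
  shows "(\<lambda>w. point p w k) \<in> measurable (PiM B (\<lambda>_. T)) XB"
  unfolding point_def
  by (rule prox_stage.measurable_iter[OF stage[OF p] g_meas Gf_measurable Gg_measurable c])
     (use B in \<open>auto simp: past_def intro!: measurable_compose[OF measurable_component_singleton]\<close>)

text \<open>Measurability is shown on the product space over any index set that contains the past. On
the past itself it expresses adaptedness, and on larger sets it combines several iterations.\<close>
lemma measurable_center:
  assumes "p \<le> P" "past p 0 \<subseteq> B"
  shows "(\<lambda>w. center w p) \<in> measurable (PiM B (\<lambda>_. T)) XB
    \<and> Measurable.pred (PiM B (\<lambda>_. T)) (\<lambda>w. out w p = None)"
  using assms
proof (induction p)
  case 0
  then show ?case using x0 by (simp add: center_def out_def space_restrict_space)
next
  case (Suc p)
  then have p: "p < P" by simp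
  have sub: "past p k \<subseteq> B" for k using Suc.prems(2) by (auto simp: past_def)
  have c: "(\<lambda>w. center w p) \<in> measurable (PiM B (\<lambda>_. T)) XB"
    and n: "Measurable.pred (PiM B (\<lambda>_. T)) (\<lambda>w. out w p = None)"
    using Suc.IH p sub by auto
  have pt: "(\<lambda>w. point p w k) \<in> measurable (PiM B (\<lambda>_. T)) XB" for k
    by (rule measurable_point_if_center[OF p c sub])
  then have ptb[measurable]: "(\<lambda>w. point p w k) \<in> borel_measurable (PiM B (\<lambda>_. T))" for k
    by (simp add: measurable_restrict_space2_iff)
  have gd[measurable]: "Measurable.pred (PiM B (\<lambda>_. T)) (\<lambda>w. good p w k)" for k
    unfolding good_def using measurable_compose[OF ptb g_meas] by measurable
  have none: "Measurable.pred (PiM B (\<lambda>_. T)) (\<lambda>w. out w p = None \<or> (\<forall>k<iters p. \<not> good p w k))"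
    using n by measurable
  have "(\<lambda>w. center w (Suc p)) \<in> borel_measurable (PiM B (\<lambda>_. T))"
    unfolding center_Suc[OF p] using none by measurable
  then have "(\<lambda>w. center w (Suc p)) \<in> measurable (PiM B (\<lambda>_. T)) XB"
    by (rule measurable_restrict_space2[rotated]) (use center_in_X[OF Suc.prems(1)] in auto)
  moreover have "out w (Suc p) = None \<longleftrightarrow> out w p = None \<or> (\<forall>k<iters p. \<not> good p w k)" for w
    unfolding out_Suc[OF p] by simp
  ultimately show ?case using none by simp
qed

lemma measurable_point:
  assumes "p < P" "past p k \<subseteq> B"
  shows "(\<lambda>w. point p w k) \<in> measurable (PiM B (\<lambda>_. T)) XB"
proof -
  have "past p 0 \<subseteq> B" using assms(2) by (auto simp: past_def)
  then show ?thesis using measurable_point_if_center assms measurable_center[of p B] by auto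
qed

section \<open>Stochastic subgradients\<close>

definition grad where "grad p x t = (if g x \<le> acc p then Gf x (fst t) else Gg x (snd t))"
definition mean where "mean p x = (if g x \<le> acc p then \<integral>w. Gf x w \<partial>\<Xi> else \<integral>w. Gg x w \<partial>Z)"
definition dev where "dev p x t = (mean p x - grad p x t) \<bullet> (x - xs)"
definition noise where "noise \<omega> = (\<lambda>(p, k). (\<xi> p k \<omega>, \<zeta> p k \<omega>))"

lemma g_XB [measurable]: "g \<in> borel_measurable XB"
  by (rule measurable_restrict_space1[OF g_meas])

lemma measurable_grad: "(\<lambda>(x, t). grad p x t) \<in> borel_measurable (XB \<Otimes>\<^sub>M T)"
proof -
  have 1: "(\<lambda>z. Gf (fst z) (fst (snd z))) \<in> borel_measurable (XB \<Otimes>\<^sub>M T)"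
    using measurable_compose[OF _ Gf_measurable, of "\<lambda>z. (fst z, fst (snd z))" "XB \<Otimes>\<^sub>M T"] by simp
  have 2: "(\<lambda>z. Gg (fst z) (snd (snd z))) \<in> borel_measurable (XB \<Otimes>\<^sub>M T)"
    using measurable_compose[OF _ Gg_measurable, of "\<lambda>z. (fst z, snd (snd z))" "XB \<Otimes>\<^sub>M T"] by simp
  show ?thesis unfolding grad_def case_prod_beta using 1 2 by measurable
qed

lemma measurable_mean: "mean p \<in> borel_measurable XB"
proof -
  have 1: "(\<lambda>x. \<integral>w. Gf x w \<partial>\<Xi>) \<in> borel_measurable XB"
    by (rule \<Xi>.borel_measurable_lebesgue_integral[OF Gf_measurable])
  have 2: "(\<lambda>x. \<integral>w. Gg x w \<partial>Z) \<in> borel_measurable XB"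
    by (rule Z.borel_measurable_lebesgue_integral[OF Gg_measurable])
  show ?thesis unfolding mean_def[abs_def] using 1 2 by measurable
qed

lemma measurable_dev: "(\<lambda>(x, t). dev p x t) \<in> borel_measurable (XB \<Otimes>\<^sub>M T)"
proof -
  have fb: "fst \<in> borel_measurable (XB \<Otimes>\<^sub>M T)"
    using measurable_fst[of XB T] by (simp add: measurable_restrict_space2_iff)
  have 1: "(\<lambda>z. mean p (fst z)) \<in> borel_measurable (XB \<Otimes>\<^sub>M T)"
    by (rule measurable_compose[OF measurable_fst measurable_mean])
  have 2: "(\<lambda>z. grad p (fst z) (snd z)) \<in> borel_measurable (XB \<Otimes>\<^sub>M T)"
    using measurable_grad[of p] by (simp add: case_prod_beta)
  show ?thesis unfolding dev_def case_prod_beta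
    by (intro borel_measurable_inner borel_measurable_diff 1 2 fb borel_measurable_const)
qed

lemma random_noise: "1 \<le> q \<Longrightarrow> random_variable T (\<lambda>\<omega>. noise \<omega> (q, j))"
  using indep unfolding indep_vars_def noise_def by fastforce

lemma random_\<xi>\<zeta>: "1 \<le> q \<Longrightarrow> random_variable \<Xi> (\<xi> q j)" "1 \<le> q \<Longrightarrow> random_variable Z (\<zeta> q j)"
  using measurable_compose[OF random_noise[of q j] measurable_fst]
    measurable_compose[OF random_noise[of q j] measurable_snd] by (simp_all add: noise_def)

lemma noise_restrict:
  assumes "B \<subseteq> {1..} \<times> UNIV" shows "(\<lambda>\<omega>. restrict (noise \<omega>) B) \<in> measurable M (PiM B (\<lambda>_. T))"
  using assms by (intro measurable_restrict) (auto intro!: random_noise)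

text \<open>Both members of the pair are arrays, because independence of two variables is stated for
variables with values in the same type.\<close>
lemma indep_history:
  "indep_var (PiM (past p k) (\<lambda>_. T)) (\<lambda>\<omega>. restrict (noise \<omega>) (past p k))
    (PiM {(Suc p, k)} (\<lambda>_. T)) (\<lambda>\<omega>. restrict (noise \<omega>) {(Suc p, k)})"
proof -
  have e: "(\<lambda>\<omega>. restrict (noise \<omega>) B) = (\<lambda>\<omega>. \<lambda>i\<in>B. (\<lambda>(p, k) \<omega>. (\<xi> p k \<omega>, \<zeta> p k \<omega>)) i \<omega>)" for B
    by (auto simp: noise_def fun_eq_iff)
  show ?thesis unfolding e by (rule indep_var_restrict[OF indep]) (auto simp: past_def)
qed

lemma grad_bound_AE:
  assumes x: "x \<in> X" and q: "1 \<le> q"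
  shows "AE \<omega> in M. \<forall>v. grad p x (noise \<omega> (q, k)) \<bullet> v \<le> Mmax * nE v"
proof -
  have dn: "\<forall>v. z \<bullet> v \<le> Mmax * nE v" if "dual_norm nE z \<le> c" "c \<le> Mmax" for z c
  proof
    fix v
    have "z \<bullet> v \<le> dual_norm nE z * nE v" by (rule inner_le_dual_norm[OF prox.norm])
    also have "\<dots> \<le> Mmax * nE v" using that is_norm_nonneg[OF prox.norm] by (intro mult_right_mono) auto
    finally show "z \<bullet> v \<le> Mmax * nE v" .
  qed
  have "AE w in distr M \<Xi> (\<xi> q k). dual_norm nE (Gf x w) \<le> Mf" unfolding \<xi>_distr[OF q] by (rule Gf_bound[OF x])
  then have 1: "AE \<omega> in M. dual_norm nE (Gf x (\<xi> q k \<omega>)) \<le> Mf" by (rule AE_distrD[OF random_\<xi>\<zeta>(1)[OF q]])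
  have "AE w in distr M Z (\<zeta> q k). dual_norm nE (Gg x w) \<le> Mg" unfolding \<zeta>_distr[OF q] by (rule Gg_bound[OF x])
  then have 2: "AE \<omega> in M. dual_norm nE (Gg x (\<zeta> q k \<omega>)) \<le> Mg" by (rule AE_distrD[OF random_\<xi>\<zeta>(2)[OF q]])
  from 1 2 show ?thesis
    by eventually_elim (use dn Mmax_facts in \<open>auto simp: grad_def noise_def\<close>)
qed

text \<open>Each oracle reads one component of a noise pair, so its law is given by the corresponding marginal.\<close>
lemma grad_expectation:
  assumes x: "x \<in> X" and q: "1 \<le> q"
  shows "integrable M (\<lambda>\<omega>. grad p x (noise \<omega> (q, k)))" "expectation (\<lambda>\<omega>. grad p x (noise \<omega> (q, k))) = mean p x"
proof -
  have 1: "integrable (distr M \<Xi> (\<xi> q k)) (Gf x)" unfolding \<xi>_distr[OF q] by (rule Gf_mean(1)[OF x])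
  have 2: "integrable (distr M Z (\<zeta> q k)) (Gg x)" unfolding \<zeta>_distr[OF q] by (rule Gg_mean(1)[OF x])
  show "integrable M (\<lambda>\<omega>. grad p x (noise \<omega> (q, k)))"
    using integrable_distr[OF random_\<xi>\<zeta>(1)[OF q] 1] integrable_distr[OF random_\<xi>\<zeta>(2)[OF q] 2]
    unfolding grad_def noise_def by (cases "g x \<le> acc p") simp_all
  have m: "Gf x \<in> borel_measurable \<Xi>" "Gg x \<in> borel_measurable Z"
    using Gf_mean(1)[OF x] Gg_mean(1)[OF x] by auto
  have "expectation (\<lambda>\<omega>. Gf x (\<xi> q k \<omega>)) = (\<integral>w. Gf x w \<partial>\<Xi>)"
    using integral_distr[OF random_\<xi>\<zeta>(1)[OF q] m(1), of k] unfolding \<xi>_distr[OF q] by simp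
  moreover have "expectation (\<lambda>\<omega>. Gg x (\<zeta> q k \<omega>)) = (\<integral>w. Gg x w \<partial>Z)"
    using integral_distr[OF random_\<xi>\<zeta>(2)[OF q] m(2), of k] unfolding \<zeta>_distr[OF q] by simp
  ultimately show "expectation (\<lambda>\<omega>. grad p x (noise \<omega> (q, k))) = mean p x"
    unfolding grad_def mean_def noise_def by simp
qed

text \<open>The subgradient enters with the factor x - xs of norm at most \<rho>, so the deviation lies
in an interval of half-length Mmax * \<rho> around the value for zero subgradient, and its mean is 0.\<close>
lemma dev_exp_moment:
  assumes x: "x \<in> X" "nE (x - xs) \<le> \<rho>" and q: "1 \<le> q" and s: "0 < s"
  shows "(\<integral>\<^sup>+\<omega>. ennreal (exp (s * dev p x (noise \<omega> (q, k)))) \<partial>M) \<le> ennreal (exp (s\<^sup>2 * (Mmax * \<rho>)\<^sup>2 / 2))"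
proof (rule nn_integral_exp_le_Hoeffding[OF _ _ _ s])
  note G = grad_expectation[OF x(1) q, of p k]
  show "integrable M (\<lambda>\<omega>. dev p x (noise \<omega> (q, k)))"
    unfolding dev_def using G(1) by simp
  have "expectation (\<lambda>\<omega>. dev p x (noise \<omega> (q, k))) = (mean p x - expectation (\<lambda>\<omega>. grad p x (noise \<omega> (q, k)))) \<bullet> (x - xs)"
    unfolding dev_def using G(1) by (simp add: prob_space)
  then show "expectation (\<lambda>\<omega>. dev p x (noise \<omega> (q, k))) = 0" using G(2) by simp
  show "AE \<omega> in M. \<bar>dev p x (noise \<omega> (q, k)) - mean p x \<bullet> (x - xs)\<bar> \<le> Mmax * \<rho>"
    using grad_bound_AE[OF x(1) q, of p k]
  proof eventually_elim
    case (elim \<omega>)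
    have "grad p x (noise \<omega> (q, k)) \<bullet> (x - xs) \<le> Mmax * nE (x - xs)"
      "grad p x (noise \<omega> (q, k)) \<bullet> (xs - x) \<le> Mmax * nE (x - xs)"
      using elim[rule_format, of "x - xs"] elim[rule_format, of "xs - x"]
      unfolding is_norm_minus_commute[OF prox.norm, of xs x] by simp_all
    moreover have "Mmax * nE (x - xs) \<le> Mmax * \<rho>" using x(2) Mmax_facts(1) by simp
    ultimately show ?case unfolding dev_def by (simp add: inner_diff_left inner_diff_right abs_le_iff)
  qed
qed


section \<open>Accumulated noise of a stage\<close>

definition noise_term where "noise_term p w k = dev p (point p w k) (w (Suc p, k))"
text \<open>The induction hypothesis on the stages: the center is as close to the solution as the radius promises.\<close>
definition on_track where "on_track p w \<longleftrightarrow> out w p \<noteq> None \<and> nE (center w p - xs) \<le> rad p"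
text \<open>The amount of noise up to which the analysis of one stage guarantees success.\<close>
definition threshold where "threshold p = real (iters p) * acc p / 2 - \<Omega> * Mmax\<^sup>2 * (rad p)\<^sup>2 / (2 * acc p)"
text \<open>The condition on the center is part of the event because the bound on the noise terms
relies on it. This makes a union bound over the stages possible.\<close>
definition too_noisy where "too_noisy p w \<longleftrightarrow> on_track p w \<and> threshold p < (\<Sum>k<iters p. noise_term p w k)"

lemma measurable_on_track:
  assumes "p \<le> P" "past p 0 \<subseteq> B"
  shows "Measurable.pred (PiM B (\<lambda>_. T)) (on_track p)"
proof -
  have c: "(\<lambda>w. center w p) \<in> borel_measurable (PiM B (\<lambda>_. T))"
    and [measurable]: "Measurable.pred (PiM B (\<lambda>_. T)) (\<lambda>w. out w p = None)"
    using measurable_center[OF assms] by (simp_all add: measurable_restrict_space2_iff)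
  have "nE \<in> borel_measurable borel"
    by (rule borel_measurable_continuous_onI[OF is_norm_continuous[OF prox.norm]])
  then have [measurable]: "(\<lambda>w. nE (center w p - xs)) \<in> borel_measurable (PiM B (\<lambda>_. T))"
    by (rule measurable_compose[rotated]) (use c in measurable)
  show ?thesis unfolding on_track_def[abs_def] by measurable
qed

lemma measurable_noise_term:
  assumes p: "p < P" and B: "past p (Suc k) \<subseteq> B"
  shows "(\<lambda>w. noise_term p w k) \<in> borel_measurable (PiM B (\<lambda>_. T))"
proof -
  have 1: "(\<lambda>w. point p w k) \<in> measurable (PiM B (\<lambda>_. T)) XB"
    by (rule measurable_point[OF p]) (use B in \<open>auto simp: past_def\<close>)
  have 2: "(\<lambda>w. w (Suc p, k)) \<in> measurable (PiM B (\<lambda>_. T)) T"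
    by (rule measurable_component_singleton) (use B in \<open>auto simp: past_def\<close>)
  show ?thesis unfolding noise_term_def
    using measurable_compose[OF measurable_Pair[OF 1 2] measurable_dev[of p]] by simp
qed

lemma on_track_cong: "(\<And>i. i \<in> past p 0 \<Longrightarrow> w i = w' i) \<Longrightarrow> on_track p w = on_track p w'"
  unfolding on_track_def using out_cong[of p w w'] center_cong[of p w w'] by metis

lemma noise_term_cong:
  assumes p: "p < P" and eq: "\<And>i. i \<in> past p (Suc k) \<Longrightarrow> w i = w' i"
  shows "noise_term p w k = noise_term p w' k"
proof -
  have "point p w k = point p w' k" by (rule point_cong[OF p eq]) (auto simp: past_def)
  moreover have "w (Suc p, k) = w' (Suc p, k)" by (rule eq) (simp add: past_def)
  ultimately show ?thesis unfolding noise_term_def by simp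
qed

lemma on_track_restrict: "on_track p (restrict w (past p k)) = on_track p w"
  by (rule on_track_cong) (auto simp: past_def)

lemma noise_term_restrict: "p < P \<Longrightarrow> j < k \<Longrightarrow> noise_term p (restrict w (past p k)) j = noise_term p w j"
  by (rule noise_term_cong) (auto simp: past_def)

lemma point_restrict: "p < P \<Longrightarrow> point p (restrict w (past p k)) k = point p w k"
  by (rule point_cong) auto

lemma too_noisy_cong:
  assumes p: "p < P" shows "too_noisy p (restrict w (past p (iters p))) = too_noisy p w"
proof -
  have "(\<Sum>k<iters p. noise_term p (restrict w (past p (iters p))) k) = (\<Sum>k<iters p. noise_term p w k)"
    by (rule sum.cong) (simp_all add: noise_term_restrict[OF p])
  then show ?thesis unfolding too_noisy_def on_track_restrict by simp
qed

lemma random_if_adapted: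
  assumes "Measurable.pred (PiM (past p k) (\<lambda>_. T)) R" "\<And>\<omega>. R (restrict (noise \<omega>) (past p k)) = R (noise \<omega>)"
  shows "{\<omega> \<in> space M. R (noise \<omega>)} \<in> sets M"
proof -
  have "past p k \<subseteq> {1..} \<times> UNIV" by (auto simp: past_def)
  then have "Measurable.pred M (\<lambda>\<omega>. R (restrict (noise \<omega>) (past p k)))"
    using measurable_compose[OF noise_restrict assms(1)] by simp
  then show ?thesis unfolding assms(2) by simp
qed

lemma too_noisy_sets:
  assumes p: "p < P" shows "{\<omega> \<in> space M. too_noisy p (noise \<omega>)} \<in> sets M"
proof (rule random_if_adapted)
  have [measurable]: "(\<lambda>w. noise_term p w k) \<in> borel_measurable (PiM (past p (iters p)) (\<lambda>_. T))" if "k < iters p" for k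
    by (rule measurable_noise_term[OF p]) (use that in \<open>auto simp: past_def\<close>)
  have [measurable]: "Measurable.pred (PiM (past p (iters p)) (\<lambda>_. T)) (on_track p)"
    by (rule measurable_on_track) (use p in \<open>auto simp: past_def\<close>)
  have "(\<lambda>w. \<Sum>k<iters p. noise_term p w k) \<in> borel_measurable (PiM (past p (iters p)) (\<lambda>_. T))"
    by (rule borel_measurable_sum) simp
  then show "Measurable.pred (PiM (past p (iters p)) (\<lambda>_. T)) (too_noisy p)"
    unfolding too_noisy_def[abs_def] by measurable
qed (rule too_noisy_cong[OF p])

lemma distance_point_solution:
  assumes p: "p < P" and ok: "on_track p w"
  shows "nE (point p w k - xs) \<le> 2 * rad p"
proof -
  have c: "center w p \<in> X" by (rule center_in_X) (use p in simp)
  have "nE (point p w k - center w p) \<le> rad p"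
    using point_in_Q[OF p c] prox_stage.Q_iff[OF stage[OF p]] by blast
  then show ?thesis
    using is_norm_triangle[OF prox.norm, of "point p w k - center w p" "center w p - xs"] ok
    unfolding on_track_def by simp
qed

text \<open>The bound on the oracle holds almost surely for each fixed point. It transfers to the random
iterate because the iterate is independent of the noise used there.\<close>
lemma grad_bound_path:
  assumes p: "p < P"
  shows "AE \<omega> in M. \<forall>v. grad p (point p (noise \<omega>) k) (noise \<omega> (Suc p, k)) \<bullet> v \<le> Mmax * nE v"
proof -
  \<comment> \<open>membership in a closed set, so that the failure of the bound is a measurable event\<close>
  define K where "K = {z. \<forall>v. z \<bullet> v \<le> Mmax * nE v}"
  have "closed K" unfolding K_def by (intro closed_Collect_all closed_Collect_le continuous_intros)
  then have K[measurable]: "K \<in> sets borel" by simp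
  let ?S = "PiM (past p k) (\<lambda>_. T)" and ?R = "PiM {(Suc p, k)} (\<lambda>_. T)"
  define \<psi> where "\<psi> = (\<lambda>(w, t). if grad p (point p w k) (t (Suc p, k)) \<in> K then 0 else 1 :: ennreal)"
  have m: "(\<lambda>z. grad p (point p (fst z) k) (snd z (Suc p, k))) \<in> borel_measurable (?S \<Otimes>\<^sub>M ?R)"
  proof -
    have 1: "(\<lambda>z. point p (fst z) k) \<in> measurable (?S \<Otimes>\<^sub>M ?R) XB"
      by (rule measurable_compose[OF measurable_fst measurable_point[OF p order_refl]])
    have 2: "(\<lambda>z. snd z (Suc p, k)) \<in> measurable (?S \<Otimes>\<^sub>M ?R) T"
      by (rule measurable_compose[OF measurable_snd measurable_component_singleton]) simp
    show ?thesis using measurable_compose[OF measurable_Pair[OF 1 2] measurable_grad[of p]] by simp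
  qed
  have \<psi>: "\<psi> \<in> borel_measurable (?S \<Otimes>\<^sub>M ?R)" unfolding \<psi>_def case_prod_beta using m by measurable
  let ?Y = "\<lambda>\<omega>. restrict (noise \<omega>) (past p k)" and ?W = "\<lambda>\<omega>. restrict (noise \<omega>) {(Suc p, k)}"
  have "(\<integral>\<^sup>+\<omega>. 1 * \<psi> (?Y \<omega>, ?W \<omega>) \<partial>M) \<le> 0 * (\<integral>\<^sup>+\<omega>. 1 \<partial>M)"
  proof (rule nn_integral_indep_step[OF indep_history _ \<psi>])
    fix w
    have "point p w k \<in> X" by (rule point_in_X[OF p center_in_X]) (use p in simp)
    then have "AE \<omega> in M. \<psi> (w, ?W \<omega>) = 0"
      using grad_bound_AE[of "point p w k" "Suc p" p k] unfolding \<psi>_def K_def by simp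
    then show "(\<integral>\<^sup>+\<omega>. \<psi> (w, ?W \<omega>) \<partial>M) \<le> 0" by (subst nn_integral_cong_AE[where v = "\<lambda>_. 0"]) auto
  qed simp
  then have z: "(\<integral>\<^sup>+\<omega>. \<psi> (?Y \<omega>, ?W \<omega>) \<partial>M) = 0" by simp
  have "(\<lambda>\<omega>. (?Y \<omega>, ?W \<omega>)) \<in> measurable M (?S \<Otimes>\<^sub>M ?R)"
    by (intro measurable_Pair noise_restrict) (auto simp: past_def)
  from measurable_compose[OF this \<psi>] have "AE \<omega> in M. \<psi> (?Y \<omega>, ?W \<omega>) = 0"
    using z by (subst (asm) nn_integral_0_iff_AE) auto
  then show ?thesis by eventually_elim
    (auto simp: \<psi>_def K_def point_restrict[OF p] split: if_splits)
qed

text \<open>One factor per iteration, by conditioning on the past. On the event that the center is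
close to xs, all iterates are within twice the radius of xs.\<close>
lemma exp_moment_path:
  assumes p: "p < P" and s: "0 < s"
  shows "(\<integral>\<^sup>+\<omega>. (if on_track p (noise \<omega>) then ennreal (exp (s * (\<Sum>k<n. noise_term p (noise \<omega>) k))) else 0) \<partial>M)
    \<le> ennreal (exp (s\<^sup>2 * (2 * Mmax * rad p)\<^sup>2 / 2)) ^ n"
proof (induction n)
  case 0
  have "(\<integral>\<^sup>+\<omega>. (if on_track p (noise \<omega>) then ennreal (exp (s * (\<Sum>k<0. noise_term p (noise \<omega>) k))) else 0) \<partial>M)
    \<le> (\<integral>\<^sup>+\<omega>. 1 \<partial>M)"
    by (rule nn_integral_mono) auto
  then show ?case by (simp add: emeasure_space_1)
next
  case (Suc n)
  let ?S = "PiM (past p n) (\<lambda>_. T)" and ?R = "PiM {(Suc p, n)} (\<lambda>_. T)"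
  let ?Y = "\<lambda>\<omega>. restrict (noise \<omega>) (past p n)" and ?W = "\<lambda>\<omega>. restrict (noise \<omega>) {(Suc p, n)}"
  let ?C = "ennreal (exp (s\<^sup>2 * (2 * Mmax * rad p)\<^sup>2 / 2))"
  define \<phi> where "\<phi> w = (if on_track p w then ennreal (exp (s * (\<Sum>k<n. noise_term p w k))) else 0)" for w
  define \<psi> where "\<psi> = (\<lambda>(w, t). ennreal (exp (s * dev p (point p w n) (t (Suc p, n)))))"
  have [measurable]: "Measurable.pred ?S (on_track p)" by (rule measurable_on_track) (use p in \<open>auto simp: past_def\<close>)
  have "(\<lambda>w. \<Sum>k<n. noise_term p w k) \<in> borel_measurable ?S"
    by (rule borel_measurable_sum) (auto intro!: measurable_noise_term[OF p] simp: past_def)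
  then have \<phi>: "\<phi> \<in> borel_measurable ?S" unfolding \<phi>_def[abs_def] by measurable
  have "(\<lambda>z. dev p (point p (fst z) n) (snd z (Suc p, n))) \<in> borel_measurable (?S \<Otimes>\<^sub>M ?R)"
  proof -
    have 1: "(\<lambda>z. point p (fst z) n) \<in> measurable (?S \<Otimes>\<^sub>M ?R) XB"
      by (rule measurable_compose[OF measurable_fst measurable_point[OF p order_refl]])
    have 2: "(\<lambda>z. snd z (Suc p, n)) \<in> measurable (?S \<Otimes>\<^sub>M ?R) T"
      by (rule measurable_compose[OF measurable_snd measurable_component_singleton]) simp
    show ?thesis using measurable_compose[OF measurable_Pair[OF 1 2] measurable_dev[of p]] by simp
  qed
  then have \<psi>: "\<psi> \<in> borel_measurable (?S \<Otimes>\<^sub>M ?R)" unfolding \<psi>_def case_prod_beta by measurable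
  have \<phi>Y: "\<phi> (?Y \<omega>) = \<phi> (noise \<omega>)" for \<omega>
    unfolding \<phi>_def on_track_restrict using noise_term_restrict[OF p, of _ n] by simp
  have \<psi>Y: "\<psi> (?Y \<omega>, ?W \<omega>) = ennreal (exp (s * noise_term p (noise \<omega>) n))" for \<omega>
    unfolding \<psi>_def noise_term_def by (simp add: point_restrict[OF p])
  have "(\<integral>\<^sup>+\<omega>. (if on_track p (noise \<omega>) then ennreal (exp (s * (\<Sum>k<Suc n. noise_term p (noise \<omega>) k))) else 0) \<partial>M)
      = (\<integral>\<^sup>+\<omega>. \<phi> (?Y \<omega>) * \<psi> (?Y \<omega>, ?W \<omega>) \<partial>M)"
    unfolding \<phi>Y \<psi>Y unfolding \<phi>_def
    by (intro nn_integral_cong) (simp add: distrib_left exp_add ennreal_mult)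
  also have "\<dots> \<le> ?C * (\<integral>\<^sup>+\<omega>. \<phi> (?Y \<omega>) \<partial>M)"
  proof (rule nn_integral_indep_step[OF indep_history \<phi> \<psi>])
    fix w assume "\<phi> w \<noteq> 0"
    then have ok: "on_track p w" unfolding \<phi>_def by (auto split: if_splits)
    have "point p w n \<in> X" by (rule point_in_X[OF p center_in_X]) (use p in simp)
    from dev_exp_moment[OF this distance_point_solution[OF p ok] _ s, of "Suc p" p n]
    show "(\<integral>\<^sup>+\<omega>. \<psi> (w, ?W \<omega>) \<partial>M) \<le> ?C" unfolding \<psi>_def
      by (simp only: case_prod_conv restrict_apply singletonI if_True mult.assoc mult.left_commute[of Mmax 2])
  qed
  also have "(\<integral>\<^sup>+\<omega>. \<phi> (?Y \<omega>) \<partial>M) \<le> ?C ^ n" using Suc unfolding \<phi>Y unfolding \<phi>_def .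
  then have "?C * (\<integral>\<^sup>+\<omega>. \<phi> (?Y \<omega>) \<partial>M) \<le> ?C * ?C ^ n" by (rule mult_left_mono) simp
  finally show ?case by simp
qed

text \<open>The two bounds on the Bregman divergence force \<Omega> to be at least 1 unless X is a point.\<close>
lemma trivial_if_\<Omega>_lt_1:
  assumes "\<Omega> < 1" "x \<in> X" "y \<in> X" shows "x = y"
proof -
  have "1 / 2 * (nE (x - y))\<^sup>2 \<le> \<Omega> / 2 * (nE (x - y))\<^sup>2"
    using assms D_superset by (intro order_trans[OF prox.strong prox.smooth]) auto
  then have "(1 - \<Omega>) * (nE (x - y))\<^sup>2 \<le> 0" by (simp add: algebra_simps)
  then have "nE (x - y) = 0" using assms(1) by (auto simp: mult_le_0_iff power_le_zero_eq)
  then show ?thesis using is_norm_eq_0[OF prox.norm] by simp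
qed

lemma threshold_pos: "0 < threshold p"
  using chernoff_exponent(1)[OF acc_pos Mmax_facts(1) rad_pos \<Omega>_pos logfac_ge iters_ge]
  unfolding threshold_def .

text \<open>Markov's inequality for the exponential moment. If \<Omega> is below 1, the feasible set is a
point and there is no noise.\<close>
lemma prob_too_noisy:
  assumes p: "p < P"
  shows "prob {\<omega> \<in> space M. too_noisy p (noise \<omega>)} \<le> exp (- (2 * logfac))"
proof (cases "1 \<le> \<Omega>")
  case False
  have "\<not> too_noisy p w" for w
  proof -
    have "point p w k = xs" for k
      by (rule trivial_if_\<Omega>_lt_1[OF _ point_in_X[OF p center_in_X] xs(1)]) (use p False in auto)
    then have "(\<Sum>k<iters p. noise_term p w k) = 0" unfolding noise_term_def dev_def by simp
    then show ?thesis using threshold_pos[of p] unfolding too_noisy_def by simp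
  qed
  then show ?thesis by simp
next
  case True
  define N where "N = real (iters p)"
  define s where "s = threshold p / (4 * N * Mmax\<^sup>2 * (rad p)\<^sup>2)"
  have s: "0 < s" unfolding s_def N_def using threshold_pos Mmax_facts(1) rad_pos[of p] iters_pos[of p] by simp
  let ?B = "{\<omega> \<in> space M. too_noisy p (noise \<omega>)}"
  have B: "?B \<in> sets M" by (rule too_noisy_sets[OF p])
  have "ennreal (exp (s * threshold p)) * emeasure M ?B = (\<integral>\<^sup>+\<omega>. ennreal (exp (s * threshold p)) * indicator ?B \<omega> \<partial>M)"
    using B by (simp add: nn_integral_cmult_indicator)
  also have "\<dots> \<le> (\<integral>\<^sup>+\<omega>. (if on_track p (noise \<omega>) then ennreal (exp (s * (\<Sum>k<iters p. noise_term p (noise \<omega>) k))) else 0) \<partial>M)"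
    by (rule nn_integral_mono) (use s in \<open>auto simp: too_noisy_def indicator_def intro!: ennreal_leI\<close>)
  also have "\<dots> \<le> ennreal (exp (s\<^sup>2 * (2 * Mmax * rad p)\<^sup>2 / 2)) ^ iters p" by (rule exp_moment_path[OF p s])
  also have "\<dots> = ennreal (exp (N * (s\<^sup>2 * (2 * Mmax * rad p)\<^sup>2 / 2)))"
    unfolding N_def by (subst exp_of_nat_mult) (simp add: ennreal_power)
  finally have "exp (s * threshold p) * prob ?B \<le> exp (N * (s\<^sup>2 * (2 * Mmax * rad p)\<^sup>2 / 2))"
    unfolding emeasure_eq_measure by (simp add: ennreal_mult[symmetric])
  then have "prob ?B \<le> exp (N * (s\<^sup>2 * (2 * Mmax * rad p)\<^sup>2 / 2)) / exp (s * threshold p)" by (simp add: field_simps)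
  also have "\<dots> = exp (N * (s\<^sup>2 * (2 * Mmax * rad p)\<^sup>2 / 2) - s * threshold p)" by (simp add: exp_diff)
  also have "\<dots> \<le> exp (- (2 * logfac))"
    using chernoff_exponent(2)[OF acc_pos Mmax_facts(1) rad_pos \<Omega>_pos logfac_ge iters_ge True]
    unfolding s_def N_def threshold_def by simp
  finally show ?thesis .
qed

section \<open>Success of the stages\<close>

lemma stage_step:
  assumes p: "p < P" and ok: "on_track p w" and nb: "\<not> too_noisy p w"
    and G: "\<And>k v. k < iters p \<Longrightarrow> grad p (point p w k) (w (Suc p, k)) \<bullet> v \<le> Mmax * nE v"
  shows "on_track (Suc p) w" "f (center w (Suc p)) - f xs \<le> acc p" "g (center w (Suc p)) \<le> acc p"
proof -
  interpret S: prox_stage nE D d gd \<Omega> X "rad p" by (rule stage[OF p])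
  have c: "center w p \<in> X" by (rule center_in_X) (use p in simp)
  have ptX: "point p w k \<in> X" for k by (rule point_in_X[OF p c])
  have xsQ: "xs \<in> S.Q (center w p)"
    using ok xs(1) is_norm_minus_commute[OF prox.norm, of "center w p" xs] by (simp add: S.Q_iff on_track_def)
  define I where "I = {k. k < iters p \<and> g (point p w k) \<le> acc p}"
  define a where "a = (1 / real (card I)) *\<^sub>R (\<Sum>k\<in>I. point p w k)"
  have noise: "(\<Sum>k<iters p. (mean p (point p w k) - grad p (point p w k) (w (Suc p, k))) \<bullet> (point p w k - xs)) \<le> threshold p"
    using nb ok unfolding too_noisy_def noise_term_def dev_def by simp
  have mf: "f (point p w k) + mean p (point p w k) \<bullet> (xs - point p w k) \<le> f xs"
    if "g (point p w k) \<le> acc p" for k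
    using Gf_mean(2)[OF ptX[of k]] xs(1) that unfolding subdifferential_def mean_def by auto
  have mg: "g (point p w k) + mean p (point p w k) \<bullet> (xs - point p w k) \<le> g xs"
    if "\<not> g (point p w k) \<le> acc p" for k
    using Gg_mean(2)[OF ptX[of k]] that unfolding subdifferential_def mean_def by auto
  have start: "point p w 0 = center w p" unfolding point_def by (rule S.iter_0[OF c])
  have step: "point p w (Suc k) = mirr (S.Q (center w p)) (S.dr (center w p)) (S.gr (center w p)) (point p w k)
      ((acc p / (Mmax\<^sup>2 * (rad p)\<^sup>2)) *\<^sub>R grad p (point p w k) (w (Suc p, k)))" for k
    unfolding point_def S.iter_Suc grad_def stepsize_def ..
  note success = S.stage_success[where x = "point p w" and G = "\<lambda>k. grad p (point p w k) (w (Suc p, k))"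
      and m = "\<lambda>k. mean p (point p w k)", OF c xsQ f g xs(2) acc_pos Mmax_facts(1) less_imp_le[OF \<Omega>_pos] iters_pos start step G
        mf mg noise[unfolded threshold_def], simplified, folded I_def, folded a_def]
  have out: "out w (Suc p) = Some a"
    using success(1) ok unfolding out_Suc[OF p] good_def a_def I_def on_track_def by auto
  then have ca: "center w (Suc p) = a" unfolding center_def by simp
  show fa: "f (center w (Suc p)) - f xs \<le> acc p" and ga: "g (center w (Suc p)) \<le> acc p"
    unfolding ca using success by auto
  have "(nE (a - xs))\<^sup>2 \<le> 2 * acc p / \<mu>"
  proof (rule quadratic_growth_at_solution[OF prox.norm X(2) f_strong _ g_strong _ solution success(2) _ _ \<mu>])
    show "subdifferential X f x \<noteq> {}" if "x \<in> X" for x using Gf_mean(2)[OF that] by blast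
    show "subdifferential UNIV g x \<noteq> {}" if "x \<in> X" for x using Gg_mean(2)[OF that] by blast
  qed (use fa ga ca in auto)
  then have "(nE (a - xs))\<^sup>2 \<le> (rad (Suc p))\<^sup>2" by (simp add: rad_Suc)
  then have "nE (a - xs) \<le> rad (Suc p)" by (rule power2_le_imp_le) (use rad_pos[of "Suc p"] in simp)
  then show "on_track (Suc p) w" unfolding on_track_def ca using out by simp
qed

lemma P_pos: "0 < P"
  unfolding P_def num_stages_eq_ceiling[OF L_pos] using L_pos by simp

definition success where
  "success w \<longleftrightarrow> out w P \<noteq> None \<and> f (center w P) - f xs \<le> \<epsilon> \<and> g (center w P) \<le> \<epsilon>
     \<and> (nE (center w P - xs))\<^sup>2 \<le> 2 * \<epsilon> / \<mu>"

text \<open>Outside the too noisy events and a null set, the stages succeed one after the other.\<close>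
lemma success_AE: "AE \<omega> in M. success (noise \<omega>) \<or> (\<exists>p<P. too_noisy p (noise \<omega>))"
proof -
  have "AE \<omega> in M. \<forall>p k. p < P \<longrightarrow> (\<forall>v. grad p (point p (noise \<omega>) k) (noise \<omega> (Suc p, k)) \<bullet> v \<le> Mmax * nE v)"
    unfolding AE_all_countable using grad_bound_path by auto
  then show ?thesis
  proof eventually_elim
    case (elim \<omega>)
    show ?case
    proof (rule disjCI)
      assume nb: "\<nexists>p. p < P \<and> too_noisy p (noise \<omega>)"
      have step: "on_track (Suc p) (noise \<omega>)" "f (center (noise \<omega>) (Suc p)) - f xs \<le> acc p"
        "g (center (noise \<omega>) (Suc p)) \<le> acc p" if "p < P" "on_track p (noise \<omega>)" for p
        proof -
        have nbp: "\<not> too_noisy p (noise \<omega>)" using nb that(1) by blast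
        have G: "grad p (point p (noise \<omega>) k) (noise \<omega> (Suc p, k)) \<bullet> v \<le> Mmax * nE v" for k v
          using elim that(1) by blast
        note stage_step[OF that nbp G]
        then show "on_track (Suc p) (noise \<omega>)" "f (center (noise \<omega>) (Suc p)) - f xs \<le> acc p"
          "g (center (noise \<omega>) (Suc p)) \<le> acc p" by simp_all
      qed
      have "on_track p (noise \<omega>)" if "p \<le> P" for p using that
      proof (induction p)
        case 0
        have "nE (x0 - xs) \<le> R0" by (rule power2_le_imp_le[OF R0(2)]) (use R0 in simp)
        then show ?case using R0(1) by (simp add: on_track_def center_def out_def rad_def radius_def)
      qed (use step(1) in auto)
      moreover obtain q where q: "P = Suc q" using P_pos by (cases P) auto
      moreover have acc: "acc q \<le> \<epsilon>"
        using final_stage_acc_le[OF \<mu> R0(1) \<epsilon> L_pos] q unfolding acc_def P_def by simp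
      ultimately have s: "on_track P (noise \<omega>)" "f (center (noise \<omega>) P) - f xs \<le> \<epsilon>" "g (center (noise \<omega>) P) \<le> \<epsilon>"
        using step(2,3)[of q] by (auto intro: order_trans)
      have "(nE (center (noise \<omega>) P - xs))\<^sup>2 \<le> (rad P)\<^sup>2"
        using s(1) is_norm_nonneg[OF prox.norm] unfolding on_track_def by (intro power_mono) auto
      also have "\<dots> \<le> 2 * \<epsilon> / \<mu>" unfolding q rad_Suc using acc \<mu> by (simp add: divide_right_mono)
      finally show "success (noise \<omega>)" using s unfolding success_def on_track_def by simp
    qed
  qed
qed

lemma prob_ge_if_success_implies:
  assumes R: "{\<omega> \<in> space M. R (noise \<omega>)} \<in> sets M" and imp: "\<And>w. success w \<Longrightarrow> R w"
  shows "1 - \<sigma> \<le> prob {\<omega> \<in> space M. R (noise \<omega>)}"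
proof -
  let ?B = "\<lambda>p. {\<omega> \<in> space M. too_noisy p (noise \<omega>)}" and ?R = "{\<omega> \<in> space M. R (noise \<omega>)}"
  have B: "?B p \<in> sets M" if "p \<in> {..<P}" for p using too_noisy_sets that by auto
  then have U: "(\<Union>p<P. ?B p) \<in> sets M" by auto
  have "AE \<omega> in M. \<omega> \<in> ?R \<union> (\<Union>p<P. ?B p)"
    using success_AE AE_space by eventually_elim (use imp in auto)
  then have "1 = prob (?R \<union> (\<Union>p<P. ?B p))" using R U prob_eq_1 by auto
  also have "\<dots> \<le> prob ?R + prob (\<Union>p<P. ?B p)" by (rule measure_Un_le[OF R U])
  also have "prob (\<Union>p<P. ?B p) \<le> (\<Sum>p<P. prob (?B p))" by (rule finite_measure_subadditive_finite) (use B in auto)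
  also have "\<dots> \<le> (\<Sum>p<P. exp (- (2 * logfac)))" by (rule sum_mono) (simp add: prob_too_noisy)
  also have "\<dots> \<le> \<sigma>" using failure_budget by simp
  finally show ?thesis by simp
qed

text \<open>The probability of a set that is not measurable is 0 by convention, so the lower bounds
on probabilities depend on this.\<close>
lemma sets_final:
  assumes "F \<in> borel_measurable XB"
  shows "{\<omega> \<in> space M. out (noise \<omega>) P \<noteq> None \<and> F (center (noise \<omega>) P) \<le> (c :: real)} \<in> sets M"
proof (rule random_if_adapted[where p = P and k = 0])
  let ?S = "PiM (past P 0) (\<lambda>_. T)"
  have c: "(\<lambda>w. center w P) \<in> measurable ?S XB" and [measurable]: "Measurable.pred ?S (\<lambda>w. out w P = None)"
    using measurable_center[of P "past P 0"] by auto
  have [measurable]: "(\<lambda>w. F (center w P)) \<in> borel_measurable ?S" by (rule measurable_compose[OF c assms])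
  show "Measurable.pred ?S (\<lambda>w. out w P \<noteq> None \<and> F (center w P) \<le> c)" by measurable
  show "(out (restrict (noise \<omega>) (past P 0)) P \<noteq> None \<and> F (center (restrict (noise \<omega>) (past P 0)) P) \<le> c)
      = (out (noise \<omega>) P \<noteq> None \<and> F (center (noise \<omega>) P) \<le> c)" for \<omega>
    using out_cong[of P "restrict (noise \<omega>) (past P 0)" "noise \<omega>"]
      center_cong[of P "restrict (noise \<omega>) (past P 0)" "noise \<omega>"] by simp
qed

lemma out_noise:
  "out (noise \<omega>) P = restarted_smd nE X g Gf Gg d gd Mf Mg \<Omega> \<mu> R0 \<epsilon> \<sigma> x0
     (\<lambda>p k. \<xi> p k \<omega>) (\<lambda>p k. \<zeta> p k \<omega>) (num_stages \<mu> R0 \<epsilon>)"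
  unfolding out_def noise_def P_def by simp

lemma out_eq_Some: "(\<exists>x. out w P = Some x \<and> R x) \<longleftrightarrow> out w P \<noteq> None \<and> R (center w P)"
  unfolding center_def by auto

lemma prob_optimal:
  "1 - \<sigma> \<le> prob {\<omega> \<in> space M. \<exists>x. out (noise \<omega>) P = Some x \<and> f x - f xs \<le> \<epsilon> \<and> g x \<le> \<epsilon>}"
proof (rule prob_ge_if_success_implies)
  \<comment> \<open>both accuracy conditions as a single inequality\<close>
  have "(\<lambda>x. max (f x - f xs) (g x)) \<in> borel_measurable XB"
    using borel_measurable_continuous_on_restrict[OF f_cont] by measurable
  from sets_final[OF this, of \<epsilon>]
  show "{\<omega> \<in> space M. \<exists>x. out (noise \<omega>) P = Some x \<and> f x - f xs \<le> \<epsilon> \<and> g x \<le> \<epsilon>} \<in> sets M"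
    unfolding out_eq_Some by simp
qed (auto simp: success_def out_eq_Some)

lemma prob_close:
  "1 - \<sigma> \<le> prob {\<omega> \<in> space M. \<exists>x. out (noise \<omega>) P = Some x \<and> (nE (x - xs))\<^sup>2 \<le> 2 * \<epsilon> / \<mu>}"
proof (rule prob_ge_if_success_implies)
  have "continuous_on X (\<lambda>x. (nE (x - xs))\<^sup>2)"
    by (intro continuous_intros continuous_on_compose2[OF is_norm_continuous[OF prox.norm, of UNIV]]) auto
  from sets_final[OF borel_measurable_continuous_on_restrict[OF this], of "2 * \<epsilon> / \<mu>"]
  show "{\<omega> \<in> space M. \<exists>x. out (noise \<omega>) P = Some x \<and> (nE (x - xs))\<^sup>2 \<le> 2 * \<epsilon> / \<mu>} \<in> sets M"
    unfolding out_eq_Some .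
qed (auto simp: success_def out_eq_Some)

end

section \<open>Convergence of the restarted method\<close>

theorem theorem9:
  fixes nE :: "'a::euclidean_space \<Rightarrow> real"
    and X D :: "'a set"
    and f g d :: "'a \<Rightarrow> real"
    and gd :: "'a \<Rightarrow> 'a"
    and Gf :: "'a \<Rightarrow> 'b \<Rightarrow> 'a"
    and Gg :: "'a \<Rightarrow> 'c \<Rightarrow> 'a"
    and \<Xi> :: "'b measure"
    and Z :: "'c measure"
    and M :: "'w measure"
    and \<xi> :: "nat \<Rightarrow> nat \<Rightarrow> 'w \<Rightarrow> 'b"
    and \<zeta> :: "nat \<Rightarrow> nat \<Rightarrow> 'w \<Rightarrow> 'c"
    and Mf Mg \<Omega> \<mu> R0 \<epsilon> \<sigma> :: real
    and x0 xs :: 'a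
  assumes norm: "is_norm nE"
    and X: "closed X" "convex X"
    and f: "convex_on X f"
    and g: "convex_on UNIV g"
    and regular: "\<exists>xb \<in> rel_interior X. g xb < 0"
    and solution: "is_arg_min f (\<lambda>x. x \<in> X \<and> g x \<le> 0) xs"
    and f_lipschitz: "\<And>x y. x \<in> X \<Longrightarrow> y \<in> X \<Longrightarrow> \<bar>f x - f y\<bar> \<le> Mf * nE (x - y)"
    and g_lipschitz: "\<And>x y. x \<in> X \<Longrightarrow> y \<in> X \<Longrightarrow> \<bar>g x - g y\<bar> \<le> Mg * nE (x - y)"
    and M_pos: "0 < max (Mf\<^sup>2) (Mg\<^sup>2)"
    and prob_spaces: "prob_space \<Xi>" "prob_space Z" "prob_space M"
    and Gf_measurable:
      "(\<lambda>(x, w). Gf x w) \<in> borel_measurable (restrict_space borel X \<Otimes>\<^sub>M \<Xi>)"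
    and Gg_measurable:
      "(\<lambda>(x, w). Gg x w) \<in> borel_measurable (restrict_space borel X \<Otimes>\<^sub>M Z)"
    and Gf_mean: "\<And>x. x \<in> X \<Longrightarrow> integrable \<Xi> (Gf x)"
      "\<And>x. x \<in> X \<Longrightarrow> (\<integral>w. Gf x w \<partial>\<Xi>) \<in> subdifferential X f x"
    and Gg_mean: "\<And>x. x \<in> X \<Longrightarrow> integrable Z (Gg x)"
      "\<And>x. x \<in> X \<Longrightarrow> (\<integral>w. Gg x w \<partial>Z) \<in> subdifferential UNIV g x"
    and Gf_bound: "\<And>x. x \<in> X \<Longrightarrow> AE w in \<Xi>. dual_norm nE (Gf x w) \<le> Mf"
    and Gg_bound: "\<And>x. x \<in> X \<Longrightarrow> AE w in Z. dual_norm nE (Gg x w) \<le> Mg"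
    and \<mu>: "0 < \<mu>"
    and f_strong: "strongly_convex nE \<mu> X X f"
    and g_strong: "strongly_convex nE \<mu> UNIV X g"
    and prox: "prox_function nE D d gd"
    and D_superset: "X \<subseteq> D"
    and D_rescaled: "\<And>p x y. p < num_stages \<mu> R0 \<epsilon> \<Longrightarrow> x \<in> X \<Longrightarrow> y \<in> X \<Longrightarrow>
      nE (x - y) \<le> radius R0 p \<Longrightarrow> (1 / radius R0 p) *\<^sub>R (x - y) \<in> D"
    and \<Omega>_pos: "0 < \<Omega>"
    and bregman_bound: "\<And>x z. x \<in> D \<Longrightarrow> z \<in> subgrad_points D d \<Longrightarrow>
      bregman d gd z x \<le> \<Omega> / 2 * (nE (x - z))\<^sup>2"
    and x0: "x0 \<in> X"
    and R0: "0 < R0" "(nE (x0 - xs))\<^sup>2 \<le> R0\<^sup>2"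
    and \<xi>_distr: "\<And>p k. 1 \<le> p \<Longrightarrow> distr M \<Xi> (\<xi> p k) = \<Xi>"
    and \<zeta>_distr: "\<And>p k. 1 \<le> p \<Longrightarrow> distr M Z (\<zeta> p k) = Z"
    and indep: "prob_space.indep_vars M (\<lambda>_. \<Xi> \<Otimes>\<^sub>M Z)
      (\<lambda>(p, k) \<omega>. (\<xi> p k \<omega>, \<zeta> p k \<omega>)) ({1..} \<times> UNIV)"
    and \<epsilon>: "0 < \<epsilon>"
    and \<sigma>: "0 < \<sigma>" "\<sigma> < 1"
    and log_factor: "2 * \<sigma> \<le> min (log_stages \<mu> R0 \<epsilon>) ((log_stages \<mu> R0 \<epsilon>)\<^sup>2)"
  shows "let L = log_stages \<mu> R0 \<epsilon>;
             P = num_stages \<mu> R0 \<epsilon>;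
             out = (\<lambda>\<omega>. restarted_smd nE X g Gf Gg d gd Mf Mg \<Omega> \<mu> R0 \<epsilon> \<sigma> x0
                     (\<lambda>p k. \<xi> p k \<omega>) (\<lambda>p k. \<zeta> p k \<omega>) P)
         in \<P>(\<omega> in M. \<exists>x. out \<omega> = Some x \<and> f x - f xs \<le> \<epsilon> \<and> g x \<le> \<epsilon>) \<ge> 1 - \<sigma>
          \<and> \<P>(\<omega> in M. \<exists>x. out \<omega> = Some x \<and> (nE (x - xs))\<^sup>2 \<le> 2 * \<epsilon> / \<mu>) \<ge> 1 - \<sigma>
          \<and> real (\<Sum>p = 1..P. stage_iters Mf Mg \<Omega> \<mu> R0 \<epsilon> \<sigma> p)
              \<le> real_of_int \<lceil>L\<rceil>
                 + 2240 * \<Omega> * max (Mf\<^sup>2) (Mg\<^sup>2) / (\<mu> * \<epsilon>) * (ln (1 / \<sigma>) + ln L)"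
proof -
  have smooth: "smooth_prox nE D d gd \<Omega>"
    by (rule smooth_prox_if_prox_function[OF norm prox bregman_bound])
  have f_cont: "continuous_on X f" by (rule continuous_on_if_norm_lipschitz[OF norm f_lipschitz])
  interpret restarted_smd_problem nE X D f g d gd Gf Gg \<Xi> Z M \<xi> \<zeta> Mf Mg \<Omega> \<mu> R0 \<epsilon> \<sigma> x0 xs
    by (rule restarted_smd_problem.intro) (fact smooth X f g solution f_cont M_pos prob_spaces Gf_measurable Gg_measurable
        Gf_mean Gg_mean Gf_bound Gg_bound \<mu> f_strong g_strong D_superset D_rescaled \<Omega>_pos x0 R0
        \<xi>_distr \<zeta>_distr indep \<epsilon> \<sigma>(1) log_factor)+
  have "0 \<le> ln (1 / \<sigma> * log_stages \<mu> R0 \<epsilon>)" using logfac_ge unfolding logfac_def by simp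
  then show ?thesis
    using prob_optimal prob_close total_iterations_le[OF \<mu> R0(1) \<epsilon> \<sigma>(1) \<Omega>_pos L_pos]
    unfolding Let_def out_noise by blast
qed

end
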